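(* For each of the life-like freezing cellular automata $T01, T02, T11, T12, S01, S02, S03, S11, S12, S13$, the problem \textsc{AsyncUnstability} is in $\mathbf{NC}$.
   Context: Cells have two states, $0$ (inactive) and $1$ (active). In the triangular grid, $G(n)$ is a rhombus-shaped region of $2n^2$ triangular cells with periodic (torus) boundary, each cell having 3 neighbors (cells sharing an edge); in the square grid, $G(n)$ is the $n\times n$ torus, each cell having 4 neighbors (von Neumann neighborhood). $N(u)$ is the set of neighbors of $u$. For integers $0\le k_1\le k_2$, the life-like freezing rule with $\mathcal{I}_F=\{k_1,\dots,k_2\}$ is $F(x)_u=1$ if $x_u=1$ or $\sum_{w\in N(u)}x_w\in\mathcal{I}_F$, and $0$ otherwise; it is named $Tk_1k_2$ on the triangular grid and $Sk_1k_2$ on the square grid. A sequential update scheme is a map $\sigma:\mathbb{N}\to G(n)$ such that each consecutive block of $|G(n)|$ steps is a permutation of the cells; $F^{\sigma(0)}(x)=x$ and at time $t$ only cell $\sigma(t)$ is updated by the local rule. \textsc{AsyncUnstability}: given $n$, a configuration $x\in\{0,1\}^{G(n)}$ and a cell $u$, decide whether there exist a sequential update scheme $\sigma$ and $T>0$ with $F^{\sigma(T)}(x)_u\neq x_u$. $\mathbf{NC}$ is the class of decision problems solvable in polylogarithmic time on a PRAM with polynomially many processors. *)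

theory Defs
  imports Main "HOL-Library.Discrete_Functions" "HOL-Computational_Algebra.Polynomial"
begin

section \<open>Parallel random access machines and NC\<close>

text \<open>
  A synchronous PRAM: all processors run the same program on private registers and a common
  shared memory of natural numbers, at unit cost per instruction. Arithmetic is restricted to
  addition, truncated subtraction and halving; unit-cost multiplication of unbounded numbers
  would make the time measure unsound.
\<close>

datatype instr =
    Const nat nat      \<comment> \<open>\<open>R[r] := c\<close>\<close>
  | Add nat nat nat    \<comment> \<open>\<open>R[r] := R[s] + R[t]\<close>\<close>
  | Sub nat nat nat    \<comment> \<open>\<open>R[r] := max 0 (R[s] - R[t])\<close>\<close>
  | Half nat nat       \<comment> \<open>\<open>R[r] := R[s] div 2\<close>\<close>
  | Load nat nat       \<comment> \<open>\<open>R[r] := M[R[s]]\<close>\<close>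
  | Store nat nat      \<comment> \<open>\<open>M[R[r]] := R[s]\<close>\<close>
  | JumpZero nat nat   \<comment> \<open>\<open>if R[r] = 0 then goto l\<close>\<close>

type_synonym proc = "nat \<times> (nat \<Rightarrow> nat)"   \<comment> \<open>program counter and registers\<close>
type_synonym memory = "nat \<Rightarrow> nat"

fun exec_instr :: "memory \<Rightarrow> instr \<Rightarrow> proc \<Rightarrow> proc" where
  "exec_instr M (Const r c) (pc, R) = (Suc pc, R(r := c))"
| "exec_instr M (Add r s t) (pc, R) = (Suc pc, R(r := R s + R t))"
| "exec_instr M (Sub r s t) (pc, R) = (Suc pc, R(r := R s - R t))"
| "exec_instr M (Half r s) (pc, R) = (Suc pc, R(r := R s div 2))"
| "exec_instr M (Load r s) (pc, R) = (Suc pc, R(r := M (R s)))"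
| "exec_instr M (Store r s) (pc, R) = (Suc pc, R)"
| "exec_instr M (JumpZero r l) (pc, R) = (if R r = 0 then l else Suc pc, R)"

definition halted :: "instr list \<Rightarrow> proc \<Rightarrow> bool" where
  "halted prog p \<longleftrightarrow> length prog \<le> fst p"

definition proc_step :: "instr list \<Rightarrow> memory \<Rightarrow> proc \<Rightarrow> proc" where
  "proc_step prog M p = (if halted prog p then p else exec_instr M (prog ! fst p) p)"

text \<open>The address and value that a processor writes in the current step, if any.\<close>

definition proc_write :: "instr list \<Rightarrow> proc \<Rightarrow> (nat \<times> nat) option" where
  "proc_write prog p =
     (if halted prog p then None
      else case prog ! fst p of Store r s \<Rightarrow> Some (snd p r, snd p s) | _ \<Rightarrow> None)"

text \<open>
  All reads of a step precede its writes. Concurrent writes are resolved by priority: the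
  processor of least index succeeds. The class NC does not depend on the conflict convention.
\<close>

definition mem_step :: "instr list \<Rightarrow> nat \<Rightarrow> (nat \<Rightarrow> proc) \<Rightarrow> memory \<Rightarrow> memory" where
  "mem_step prog P S M a =
     (let writes = (\<lambda>i. i < P \<and> (\<exists>v. proc_write prog (S i) = Some (a, v)))
      in if \<exists>i. writes i then snd (the (proc_write prog (S (LEAST i. writes i)))) else M a)"

fun pram_step :: "instr list \<Rightarrow> nat \<Rightarrow> (nat \<Rightarrow> proc) \<times> memory \<Rightarrow> (nat \<Rightarrow> proc) \<times> memory" where
  "pram_step prog P (S, M) = (\<lambda>i. proc_step prog M (S i), mem_step prog P S M)"

text \<open>
  Initially register 0 holds the index of the processor, register 1 the length of the input,
  and memory cells \<open>0, 1, \<dots>\<close> the bits of the input; everything else is 0.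
\<close>

definition pram_init :: "bool list \<Rightarrow> (nat \<Rightarrow> proc) \<times> memory" where
  "pram_init w =
     (\<lambda>i. (0, (\<lambda>_. 0)(0 := i, 1 := length w)),
      \<lambda>a. if a < length w \<and> w ! a then 1 else 0)"

definition pram_run :: "instr list \<Rightarrow> nat \<Rightarrow> bool list \<Rightarrow> nat \<Rightarrow> (nat \<Rightarrow> proc) \<times> memory" where
  "pram_run prog P w t = (pram_step prog P ^^ t) (pram_init w)"

text \<open>
  The number of processors is the exact value of a fixed polynomial rather than an arbitrary
  polynomially bounded function of the input length, which could carry non-uniform advice.
  The verdict is read off memory cell 0.
\<close>

definition NC :: "bool list set set" where
  "NC = {L. \<exists>(prog :: instr list) (procs :: nat poly) (time :: nat poly). \<forall>w. \<exists>t S M.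
          t \<le> poly time (floor_log (length w)) \<and>
          pram_run prog (poly procs (length w)) w t = (S, M) \<and>
          (\<forall>i < poly procs (length w). halted prog (S i)) \<and>
          (M 0 = 1 \<longleftrightarrow> w \<in> L)}"


section \<open>Freezing life-like rules under sequential updating\<close>

definition lifelike_freezing ::
  "('c \<Rightarrow> 'c set) \<Rightarrow> nat \<Rightarrow> nat \<Rightarrow> ('c \<Rightarrow> bool) \<Rightarrow> ('c \<Rightarrow> bool)" where
  "lifelike_freezing N k1 k2 x u \<longleftrightarrow> x u \<or> (\<Sum>w\<in>N u. of_bool (x w)) \<in> {k1..k2}"

definition sequential_scheme :: "'c set \<Rightarrow> (nat \<Rightarrow> 'c) \<Rightarrow> bool" where
  "sequential_scheme G \<sigma> \<longleftrightarrow> (\<forall>b. bij_betw \<sigma> {b * card G ..< Suc b * card G} G)"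

primrec seq_iterate ::
  "(('c \<Rightarrow> bool) \<Rightarrow> ('c \<Rightarrow> bool)) \<Rightarrow> (nat \<Rightarrow> 'c) \<Rightarrow> ('c \<Rightarrow> bool) \<Rightarrow> nat \<Rightarrow> ('c \<Rightarrow> bool)" where
  "seq_iterate F \<sigma> x 0 = x"
| "seq_iterate F \<sigma> x (Suc t) =
     (let y = seq_iterate F \<sigma> x t in y(\<sigma> t := F y (\<sigma> t)))"

definition async_unstable ::
  "'c set \<Rightarrow> (('c \<Rightarrow> bool) \<Rightarrow> ('c \<Rightarrow> bool)) \<Rightarrow> ('c \<Rightarrow> bool) \<Rightarrow> 'c \<Rightarrow> bool" where
  "async_unstable G F x u \<longleftrightarrow>
     (\<exists>\<sigma> T. sequential_scheme G \<sigma> \<and> T > 0 \<and> seq_iterate F \<sigma> x T u \<noteq> x u)"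


section \<open>The two grids\<close>

definition square_grid :: "nat \<Rightarrow> (nat \<times> nat) set" where
  "square_grid n = {..<n} \<times> {..<n}"

fun square_nbhd :: "nat \<Rightarrow> nat \<times> nat \<Rightarrow> (nat \<times> nat) set" where
  "square_nbhd n (i, j) =
     {((i + 1) mod n, j), ((i + n - 1) mod n, j), (i, (j + 1) mod n), (i, (j + n - 1) mod n)}"

text \<open>
  The \<open>n \<times> n\<close> rhombus is cut into unit rhombi \<open>(i, j)\<close>, and each of these along its short
  diagonal into an upward triangle \<open>(i, j, False)\<close> and a downward triangle \<open>(i, j, True)\<close>.
\<close>

definition triangular_grid :: "nat \<Rightarrow> (nat \<times> nat \<times> bool) set" where
  "triangular_grid n = {..<n} \<times> {..<n} \<times> UNIV"

fun triangular_nbhd :: "nat \<Rightarrow> nat \<times> nat \<times> bool \<Rightarrow> (nat \<times> nat \<times> bool) set" where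
  "triangular_nbhd n (i, j, False) =
     {(i, j, True), ((i + n - 1) mod n, j, True), (i, (j + n - 1) mod n, True)}"
| "triangular_nbhd n (i, j, True) =
     {(i, j, False), ((i + 1) mod n, j, False), (i, (j + 1) mod n, False)}"


section \<open>The decision problem\<close>

text \<open>
  Instances are coded as binary words. The side length and the coordinates of the cell are
  written in unary; as the configuration alone takes at least \<open>n\<^sup>2\<close> bits, this agrees
  with a binary coding up to a polynomial in the size of the input.
\<close>

definition unary :: "nat \<Rightarrow> bool list" where
  "unary m = replicate m True @ [False]"

fun encode_square :: "nat \<Rightarrow> (nat \<times> nat \<Rightarrow> bool) \<Rightarrow> nat \<times> nat \<Rightarrow> bool list" where
  "encode_square n x (i, j) =
     unary n @ unary i @ unary j @ [x (a, b). a \<leftarrow> [0..<n], b \<leftarrow> [0..<n]]"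

fun encode_triangular ::
  "nat \<Rightarrow> (nat \<times> nat \<times> bool \<Rightarrow> bool) \<Rightarrow> nat \<times> nat \<times> bool \<Rightarrow> bool list" where
  "encode_triangular n x (i, j, d) =
     unary n @ unary i @ unary j @ [d] @
     [x (a, b, e). a \<leftarrow> [0..<n], b \<leftarrow> [0..<n], e \<leftarrow> [False, True]]"

definition AsyncUnstability_S :: "nat \<Rightarrow> nat \<Rightarrow> bool list set" where
  "AsyncUnstability_S k1 k2 =
     {encode_square n x u | n x u.
        n \<ge> 1 \<and> u \<in> square_grid n \<and>
        async_unstable (square_grid n) (lifelike_freezing (square_nbhd n) k1 k2) x u}"

definition AsyncUnstability_T :: "nat \<Rightarrow> nat \<Rightarrow> bool list set" where
  "AsyncUnstability_T k1 k2 =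
     {encode_triangular n x u | n x u.
        n \<ge> 1 \<and> u \<in> triangular_grid n \<and>
        async_unstable (triangular_grid n) (lifelike_freezing (triangular_nbhd n) k1 k2) x u}"

end

theory Submission
  imports Defs
begin

text \<open>
  Since rules are freezing, only the order in which cells become active matters, and any order of
  distinct cells is a prefix of some sequential scheme. For \<open>k1 \<le> 1 \<le> k2\<close> a cell
  \<open>u\<close> can be activated if and only if, in the initial configuration, a path of inactive cells
  leads from \<open>u\<close> to a cell that can fire at once, all cells before the last one having no
  active neighbour: such a path of minimal length can be fired backwards, each cell seeing exactly
  one active neighbour at its turn. For \<open>k1 = 0\<close> a path of length 0 suffices.

  Reachability is decided by repeated squaring of the adjacency matrix with one processor for each
  triple of vertices. All processors run in lockstep; loops run as many times as the input length
  has binary digits, and this number is the same for all processors.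
\<close>

section \<open>Data-parallel programs on a PRAM\<close>

text \<open>The machine model is the obstacle. Time must be polylogarithmic, the processors branch
  independently and cannot multiply, and their number is a fixed polynomial in the input length.
  Branching is therefore replaced by predication: each instruction carries a guard register and
  takes the same time whether or not it has an effect, so one program counter serves all processors
  and a program is verified as a map on register files and memory. All loops run
  \<open>K = nbits L\<close> times for input length \<open>L\<close>. This makes
  \<open>m = 2 ^ K\<close> the natural unit: \<open>m\<close> exceeds \<open>L\<close>, arises by
  doubling, and quotients and remainders by \<open>m\<close> are shifts, so a processor index splits
  into three digits naming a triple of vertices. Since \<open>m \<le> 2 * L + 1\<close>,
  \<open>(2 * L + 1) ^ 3\<close> processors suffice, and surplus ones do no harm. Squaring takes
  \<open>2 * K\<close> rounds, enough for paths of length \<open>m * m\<close>, a bound on the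
  number of edges. The predicate \<open>accepts\<close> on words separates machine from grid: the
  program decides it for all words, malformed ones included, and it holds exactly for the codes of
  unstable instances.\<close>

text \<open>
  Register 2 is always 0 and register 3 always 1, register 64 counts loop iterations, the registers
  from 65 on hold intermediate results, and those from 4 to 63 are free for programs.
\<close>

type_synonym simd = "(nat \<Rightarrow> nat \<Rightarrow> nat) \<times> memory"

text \<open>The guard register decides for each processor separately whether the instruction takes
  effect. The \<open>LEAST\<close> among the active writers is the priority rule of
  \<open>mem_step\<close>.\<close>

fun guarded_step :: "nat \<Rightarrow> nat \<times> instr \<Rightarrow> simd \<Rightarrow> simd" where
  "guarded_step P (g, c) (R, M) =
     (\<lambda>i. if R i g \<noteq> 0 then snd (exec_instr M c (0, R i)) else R i,
      \<lambda>a. case c of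
            Store r s \<Rightarrow>
              (if \<exists>i<P. R i g \<noteq> 0 \<and> R i r = a
               then R (LEAST i. i < P \<and> R i g \<noteq> 0 \<and> R i r = a) s else M a)
          | _ \<Rightarrow> M a)"

text \<open>Both branches take three steps, so that the processors meet again.\<close>

fun guarded_code :: "nat \<Rightarrow> nat \<times> instr \<Rightarrow> instr list" where
  "guarded_code pc (g, c) =
     [JumpZero g (pc + 3), c, JumpZero 2 (pc + 5), JumpZero 2 (pc + 4), JumpZero 2 (pc + 5)]"

text \<open>Unconditional jumps are written \<open>JumpZero 2\<close>, so register 2 must stay zero.
  Guarded jumps are excluded because they would separate the processors.\<close>

fun keeps_zero :: "instr \<Rightarrow> bool" where
  "keeps_zero (Const r c) \<longleftrightarrow> r \<noteq> 2"
| "keeps_zero (Add r s t) \<longleftrightarrow> r \<noteq> 2"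
| "keeps_zero (Sub r s t) \<longleftrightarrow> r \<noteq> 2"
| "keeps_zero (Half r s) \<longleftrightarrow> r \<noteq> 2"
| "keeps_zero (Load r s) \<longleftrightarrow> r \<noteq> 2"
| "keeps_zero (Store r s) \<longleftrightarrow> True"
| "keeps_zero (JumpZero r l) \<longleftrightarrow> False"

lemma guarded_step_zero:
  assumes "keeps_zero c" and "\<forall>i. R i 2 = 0" and "guarded_step P (g, c) (R, M) = (R', M')"
  shows "\<forall>i. R' i 2 = 0"
  using assms by (cases c) auto

lemma mem_step_no_write:
  assumes "\<And>i. proc_write prog (S i) = None"
  shows "mem_step prog P S M = M"
  using assms by (auto simp: mem_step_def fun_eq_iff)

lemma pram_step_jumps:
  assumes "\<And>i. fst (S i) < length prog" and "\<And>i. \<exists>r l. prog ! fst (S i) = JumpZero r l"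
  shows "pram_step prog P (S, M) = (\<lambda>i. exec_instr M (prog ! fst (S i)) (S i), M)"
proof -
  have "proc_write prog (S i) = None" for i
    using assms(2)[of i] by (auto simp: proc_write_def)
  then show ?thesis
    using assms(1) by (simp add: mem_step_no_write proc_step_def halted_def fun_eq_iff not_le[symmetric])
qed

lemma nth_code_segment:
  assumes "prog = pre @ code @ post" and "length pre = pc" and "k < length code"
  shows "prog ! (pc + k) = code ! k" and "pc + k < length prog"
  using assms by (auto simp: nth_append)

declare pram_step.simps [simp del]

text \<open>Active processors visit \<open>pc\<close>, \<open>pc + 1\<close>, \<open>pc + 2\<close>,
  idle ones \<open>pc\<close>, \<open>pc + 3\<close>, \<open>pc + 4\<close>, and both arrive at
  \<open>pc + 5\<close>. Only the second step can write, and only active processors write in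
  it.\<close>

lemma guarded_code_run:
  assumes prog: "prog = pre @ guarded_code pc (g, c) @ post" and pc: "length pre = pc"
    and zero: "\<forall>i. R i 2 = 0" and kz: "keeps_zero c"
    and step: "guarded_step P (g, c) (R, M) = (R', M')"
  shows "(pram_step prog P ^^ 3) (\<lambda>i. (pc, R i), M) = (\<lambda>i. (pc + 5, R' i), M')"
proof -
  note nth = nth_code_segment[OF prog pc]
  have p: "prog ! pc = JumpZero g (pc + 3)" "prog ! (pc + 1) = c"
    "prog ! (pc + 2) = JumpZero 2 (pc + 5)" "prog ! (pc + 3) = JumpZero 2 (pc + 4)"
    "prog ! (pc + 4) = JumpZero 2 (pc + 5)" "pc + 4 < length prog"
    using nth[of 0] nth[of 1] nth[of 2] nth[of 3] nth[of 4] by (simp_all add: numeral_eq_Suc)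
  define S1 where "S1 = (\<lambda>i. (if R i g = 0 then pc + 3 else pc + 1, R i))"
  define S2 where "S2 = (\<lambda>i. (if R i g = 0 then pc + 4 else pc + 2, R' i))"
  have zero': "\<forall>i. R' i 2 = 0"
    using guarded_step_zero[OF kz zero step] .
  have 1: "pram_step prog P (\<lambda>i. (pc, R i), M) = (S1, M)"
    using p by (subst pram_step_jumps) (auto simp: S1_def fun_eq_iff)
  have "proc_step prog M (S1 i) = S2 i" for i
    using p zero step kz by (cases c) (auto simp: S1_def S2_def proc_step_def halted_def)
  moreover have "mem_step prog P S1 M = M'"
  proof -
    have M': "M' = snd (guarded_step P (g, c) (R, M))" using step by simp
    have w: "proc_write prog (S1 i) =
        (if R i g = 0 then None else case c of Store r s \<Rightarrow> Some (R i r, R i s) | _ \<Rightarrow> None)" for i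
      using p by (cases c) (auto simp: S1_def proc_write_def halted_def)
    show ?thesis
    proof (cases "\<exists>r s. c = Store r s")
      case True
      then obtain r s where c: "c = Store r s" by blast
      have "mem_step prog P S1 M a = M' a" for a
      proof -
        let ?W = "\<lambda>i. i < P \<and> R i g \<noteq> 0 \<and> R i r = a"
        have W: "(i < P \<and> (\<exists>v. proc_write prog (S1 i) = Some (a, v))) = ?W i" for i
          by (auto simp: w c)
        have M'a: "M' a = (if \<exists>i. ?W i then R (LEAST i. ?W i) s else M a)"
          unfolding M' by (simp add: c)
        show ?thesis
        proof (cases "\<exists>i. ?W i")
          case True
          \<comment> \<open>The least writer is itself a writer, so \<open>the\<close> in
            \<open>mem_step\<close> meets a \<open>Some\<close>.\<close>
          then have "?W (LEAST i. ?W i)" by (rule LeastI_ex)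
          then show ?thesis
            using True unfolding mem_step_def Let_def W M'a by (simp add: w c del: neq0_conv)
        next
          case False
          then show ?thesis
            unfolding mem_step_def Let_def W M'a by (simp only: False if_False)
        qed
      qed
      then show ?thesis by blast
    next
      case False
      then have "M' = M" using step by (cases c) auto
      moreover have "proc_write prog (S1 i) = None" for i
        using False by (cases c) (auto simp: w)
      ultimately show ?thesis by (simp add: mem_step_no_write)
    qed
  qed
  ultimately have 2: "pram_step prog P (S1, M) = (S2, M')" by (simp add: pram_step.simps)
  have 3: "pram_step prog P (S2, M') = (\<lambda>i. (pc + 5, R' i), M')"
    using p zero' by (subst pram_step_jumps) (auto simp: S2_def fun_eq_iff)
  show ?thesis
    using 1 2 3 by (simp add: numeral_3_eq_3)
qed

fun block_code :: "nat \<Rightarrow> (nat \<times> instr) list \<Rightarrow> instr list" where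
  "block_code pc [] = []"
| "block_code pc (x # xs) = guarded_code pc x @ block_code (pc + 5) xs"

lemma length_block_code [simp]: "length (block_code pc xs) = 5 * length xs"
proof (induction xs arbitrary: pc)
  case (Cons x xs)
  then show ?case by (cases x) simp
qed simp

lemma funpow_add_apply: "(f ^^ m) x = y \<Longrightarrow> (f ^^ n) y = z \<Longrightarrow> (f ^^ (m + n)) x = z"
  by (simp add: add.commute[of m n] funpow_add)

lemma block_code_run:
  assumes "prog = pre @ block_code pc xs @ post" and "length pre = pc"
    and "\<forall>i. R i 2 = 0" and "\<forall>x\<in>set xs. keeps_zero (snd x)"
    and "fold (guarded_step P) xs (R, M) = (R', M')"
  shows "(pram_step prog P ^^ (3 * length xs)) (\<lambda>i. (pc, R i), M)
           = (\<lambda>i. (pc + 5 * length xs, R' i), M')"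
  using assms
proof (induction xs arbitrary: pc pre R M)
  case (Cons x xs)
  obtain g c where x: "x = (g, c)" by (cases x)
  obtain R1 M1 where s: "guarded_step P (g, c) (R, M) = (R1, M1)" by force
  have a: "(pram_step prog P ^^ 3) (\<lambda>i. (pc, R i), M) = (\<lambda>i. (pc + 5, R1 i), M1)"
    by (rule guarded_code_run[OF _ Cons.prems(2,3) _ s]) (use Cons.prems x in auto)
  have b: "(pram_step prog P ^^ (3 * length xs)) (\<lambda>i. (pc + 5, R1 i), M1)
      = (\<lambda>i. (pc + 5 + 5 * length xs, R' i), M')"
  proof (rule Cons.IH)
    show "prog = (pre @ guarded_code pc x) @ block_code (pc + 5) xs @ post"
      using Cons.prems by simp
    show "\<forall>i. R1 i 2 = 0"
      by (rule guarded_step_zero[OF _ Cons.prems(3) s]) (use Cons.prems x in auto)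
  qed (use Cons.prems x s in auto)
  show ?case
    using funpow_add_apply[OF a b] by (simp add: ac_simps)
qed simp

section \<open>Expressions without branching\<close>

datatype exp =
    Lit nat
  | Reg nat
  | Plus exp exp
  | Minus exp exp
  | Halve exp
  | Deref exp
  | IfNZ exp exp exp

fun eval :: "exp \<Rightarrow> (nat \<Rightarrow> nat) \<Rightarrow> memory \<Rightarrow> nat" where
  "eval (Lit c) V M = c"
| "eval (Reg r) V M = V r"
| "eval (Plus a b) V M = eval a V M + eval b V M"
| "eval (Minus a b) V M = eval a V M - eval b V M"
| "eval (Halve a) V M = eval a V M div 2"
| "eval (Deref a) V M = M (eval a V M)"
| "eval (IfNZ c a b) V M = (if eval c V M \<noteq> 0 then eval a V M else eval b V M)"

fun wf_exp :: "exp \<Rightarrow> bool" where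
  "wf_exp (Lit c) = True"
| "wf_exp (Reg r) = (r < 64)"
| "wf_exp (Plus a b) = (wf_exp a \<and> wf_exp b)"
| "wf_exp (Minus a b) = (wf_exp a \<and> wf_exp b)"
| "wf_exp (Halve a) = wf_exp a"
| "wf_exp (Deref a) = wf_exp a"
| "wf_exp (IfNZ c a b) = (wf_exp c \<and> wf_exp a \<and> wf_exp b)"

text \<open>A stack discipline: the value lands in register \<open>k\<close>, temporaries lie above,
  and registers below \<open>k\<close> survive. Both branches of \<open>IfNZ\<close> are evaluated,
  harmlessly since \<open>eval\<close> is total; register \<open>k\<close> then guards the move of
  the first value over the second.\<close>

fun exp_code :: "exp \<Rightarrow> nat \<Rightarrow> (nat \<times> instr) list" where
  "exp_code (Lit c) k = [(3, Const k c)]"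
| "exp_code (Reg r) k = [(3, Add k r 2)]"
| "exp_code (Plus a b) k = exp_code a k @ exp_code b (k + 1) @ [(3, Add k k (k + 1))]"
| "exp_code (Minus a b) k = exp_code a k @ exp_code b (k + 1) @ [(3, Sub k k (k + 1))]"
| "exp_code (Halve a) k = exp_code a k @ [(3, Half k k)]"
| "exp_code (Deref a) k = exp_code a k @ [(3, Load k k)]"
| "exp_code (IfNZ c a b) k = exp_code c k @ exp_code a (k + 1) @ exp_code b (k + 2) @
     [(k, Add (k + 2) (k + 1) 2), (3, Add k (k + 2) 2)]"

lemma exp_code_keeps_zero: "64 < k \<Longrightarrow> \<forall>x\<in>set (exp_code e k). keeps_zero (snd x)"
proof (induction e arbitrary: k)
  case (Plus a b)
  then show ?case using Plus.IH(1)[of k] Plus.IH(2)[of "Suc k"] by auto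
next
  case (Minus a b)
  then show ?case using Minus.IH(1)[of k] Minus.IH(2)[of "Suc k"] by auto
next
  case (IfNZ c a b)
  then show ?case
    using IfNZ.IH(1)[of k] IfNZ.IH(2)[of "Suc k"] IfNZ.IH(3)[of "Suc (Suc k)"] by auto
qed auto

lemma eval_cong: "wf_exp e \<Longrightarrow> (\<And>r. r < 64 \<Longrightarrow> V r = V' r) \<Longrightarrow> eval e V M = eval e V' M"
  by (induction e) auto

text \<open>The frame clause for registers below \<open>k\<close> carries the induction: it protects
  operands already computed and, as \<open>wf_exp\<close> reads only registers below 64, preserves
  the meaning of later operands.\<close>

lemma exp_code_correct:
  assumes "wf_exp e" and "64 < k" and "\<forall>i. R i 2 = 0 \<and> R i 3 = 1"
  shows "\<exists>R'. fold (guarded_step P) (exp_code e k) (R, M) = (R', M) \<and>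
           (\<forall>i. R' i k = eval e (R i) M \<and> (\<forall>r<k. R' i r = R i r))"
  using assms
proof (induction e arbitrary: k R)
  case (Lit c)
  then show ?case by auto
next
  case (Reg r)
  then show ?case by auto
next
  case (Plus a b)
  obtain R1 where 1: "fold (guarded_step P) (exp_code a k) (R, M) = (R1, M)"
      "\<forall>i. R1 i k = eval a (R i) M \<and> (\<forall>r<k. R1 i r = R i r)"
    using Plus.IH(1)[of k R] Plus.prems by auto
  obtain R2 where 2: "fold (guarded_step P) (exp_code b (k + 1)) (R1, M) = (R2, M)"
      "\<forall>i. R2 i (k+1) = eval b (R1 i) M \<and> (\<forall>r<k+1. R2 i r = R1 i r)"
    using Plus.IH(2)[of "k+1" R1] Plus.prems 1(2) by auto
  have "eval b (R1 i) M = eval b (R i) M" for i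
    by (rule eval_cong) (use Plus.prems 1(2) in auto)
  then show ?case
    using 1 2 Plus.prems by auto
next
  case (Minus a b)
  obtain R1 where 1: "fold (guarded_step P) (exp_code a k) (R, M) = (R1, M)"
      "\<forall>i. R1 i k = eval a (R i) M \<and> (\<forall>r<k. R1 i r = R i r)"
    using Minus.IH(1)[of k R] Minus.prems by auto
  obtain R2 where 2: "fold (guarded_step P) (exp_code b (k + 1)) (R1, M) = (R2, M)"
      "\<forall>i. R2 i (k+1) = eval b (R1 i) M \<and> (\<forall>r<k+1. R2 i r = R1 i r)"
    using Minus.IH(2)[of "k+1" R1] Minus.prems 1(2) by auto
  have "eval b (R1 i) M = eval b (R i) M" for i
    by (rule eval_cong) (use Minus.prems 1(2) in auto)
  then show ?case
    using 1 2 Minus.prems by auto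
next
  case (Halve a)
  obtain R1 where 1: "fold (guarded_step P) (exp_code a k) (R, M) = (R1, M)"
      "\<forall>i. R1 i k = eval a (R i) M \<and> (\<forall>r<k. R1 i r = R i r)"
    using Halve.IH(1)[of k R] Halve.prems by auto
  then show ?case using Halve.prems by auto
next
  case (Deref a)
  obtain R1 where 1: "fold (guarded_step P) (exp_code a k) (R, M) = (R1, M)"
      "\<forall>i. R1 i k = eval a (R i) M \<and> (\<forall>r<k. R1 i r = R i r)"
    using Deref.IH(1)[of k R] Deref.prems by auto
  then show ?case using Deref.prems by auto
next
  case (IfNZ c a b)
  obtain R1 where 1: "fold (guarded_step P) (exp_code c k) (R, M) = (R1, M)"
      "\<forall>i. R1 i k = eval c (R i) M \<and> (\<forall>r<k. R1 i r = R i r)"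
    using IfNZ.IH(1)[of k R] IfNZ.prems by auto
  obtain R2 where 2: "fold (guarded_step P) (exp_code a (k + 1)) (R1, M) = (R2, M)"
      "\<forall>i. R2 i (k+1) = eval a (R1 i) M \<and> (\<forall>r<k+1. R2 i r = R1 i r)"
    using IfNZ.IH(2)[of "k+1" R1] IfNZ.prems 1(2) by auto
  obtain R3 where 3: "fold (guarded_step P) (exp_code b (k + 2)) (R2, M) = (R3, M)"
      "\<forall>i. R3 i (k+2) = eval b (R2 i) M \<and> (\<forall>r<k+2. R3 i r = R2 i r)"
    using IfNZ.IH(3)[of "k+2" R2] IfNZ.prems 1(2) 2(2) by auto
  have "eval a (R1 i) M = eval a (R i) M" "eval b (R2 i) M = eval b (R i) M" for i
    by (rule eval_cong; use IfNZ.prems 1(2) 2(2) in auto)+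
  then show ?case
    using 1 2 3 IfNZ.prems by auto
qed

section \<open>Commands and their simulation\<close>

datatype cmd =
    Assign nat exp
  | StoreIf exp exp exp   \<comment> \<open>guard, address and value\<close>

fun cmd_sem :: "nat \<Rightarrow> cmd \<Rightarrow> simd \<Rightarrow> simd" where
  "cmd_sem P (Assign r e) (V, M) = (\<lambda>i. (V i)(r := eval e (V i) M), M)"
| "cmd_sem P (StoreIf g a v) (V, M) =
     (V, \<lambda>x. if \<exists>i<P. eval g (V i) M \<noteq> 0 \<and> eval a (V i) M = x
             then eval v (V (LEAST i. i < P \<and> eval g (V i) M \<noteq> 0 \<and> eval a (V i) M = x)) M
             else M x)"

text \<open>Confining assignments to registers 4 to 63 protects the processor index, the input
  length, the two constants and the loop counter.\<close>

fun wf_cmd :: "cmd \<Rightarrow> bool" where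
  "wf_cmd (Assign r e) = (4 \<le> r \<and> r < 64 \<and> wf_exp e)"
| "wf_cmd (StoreIf g a v) = (wf_exp g \<and> wf_exp a \<and> wf_exp v)"

fun cmd_code :: "cmd \<Rightarrow> (nat \<times> instr) list" where
  "cmd_code (Assign r e) = exp_code e 65 @ [(3, Add r 65 2)]"
| "cmd_code (StoreIf g a v) =
     exp_code g 65 @ exp_code a 66 @ exp_code v 67 @ [(65, Store 66 67)]"

text \<open>The refinement relation between machine and command level: \<open>q\<close> is the loop
  counter, and the temporaries from 65 on are left free.\<close>

definition sim :: "nat \<Rightarrow> (nat \<Rightarrow> nat \<Rightarrow> nat) \<Rightarrow> (nat \<Rightarrow> nat \<Rightarrow> nat) \<Rightarrow> bool" where
  "sim q R V \<longleftrightarrow> (\<forall>i. R i 64 = q \<and> (\<forall>r<64. R i r = V i r))"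

definition consts_ok :: "nat \<Rightarrow> (nat \<Rightarrow> nat \<Rightarrow> nat) \<Rightarrow> bool" where
  "consts_ok L V \<longleftrightarrow> (\<forall>i. V i 1 = L \<and> V i 2 = 0 \<and> V i 3 = 1)"

lemma cmd_code_keeps_zero: "wf_cmd c \<Longrightarrow> x \<in> set (cmd_code c) \<Longrightarrow> keeps_zero (snd x)"
  by (cases c) (use exp_code_keeps_zero[of 65] exp_code_keeps_zero[of 66] exp_code_keeps_zero[of 67] in auto)

lemma cmd_code_correct:
  assumes "wf_cmd c" and "sim q R V" and "consts_ok L V" and "cmd_sem P c (V, M) = (V', M')"
  shows "\<exists>R'. fold (guarded_step P) (cmd_code c) (R, M) = (R', M') \<and> sim q R' V' \<and> consts_ok L V'"
proof -
  have R: "\<forall>i. R i 2 = 0 \<and> R i 3 = 1"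
    using assms(2,3) by (auto simp: sim_def consts_ok_def)
  have ev: "eval e (R i) M = eval e (V i) M" if "wf_exp e" for e i
    by (rule eval_cong[OF that]) (use assms(2) in \<open>auto simp: sim_def\<close>)
  show ?thesis
  proof (cases c)
    case (Assign r e)
    obtain R1 where 1: "fold (guarded_step P) (exp_code e 65) (R, M) = (R1, M)"
        "\<forall>i. R1 i 65 = eval e (R i) M \<and> (\<forall>r<65. R1 i r = R i r)"
      using exp_code_correct[of e 65 R P M] assms(1) R Assign by auto
    then show ?thesis
      using assms R ev[of e] by (auto simp: Assign sim_def consts_ok_def)
  next
    case (StoreIf g a v)
    obtain R1 where 1: "fold (guarded_step P) (exp_code g 65) (R, M) = (R1, M)"
        "\<forall>i. R1 i 65 = eval g (R i) M \<and> (\<forall>r<65. R1 i r = R i r)"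
      using exp_code_correct[of g 65 R P M] assms(1) R StoreIf by auto
    obtain R2 where 2: "fold (guarded_step P) (exp_code a 66) (R1, M) = (R2, M)"
        "\<forall>i. R2 i 66 = eval a (R1 i) M \<and> (\<forall>r<66. R2 i r = R1 i r)"
      using exp_code_correct[of a 66 R1 P M] assms(1) R 1 StoreIf by auto
    obtain R3 where 3: "fold (guarded_step P) (exp_code v 67) (R2, M) = (R3, M)"
        "\<forall>i. R3 i 67 = eval v (R2 i) M \<and> (\<forall>r<67. R3 i r = R2 i r)"
      using exp_code_correct[of v 67 R2 P M] assms(1) R 1 2 StoreIf by auto
    have e: "eval a (R1 i) M = eval a (R i) M" "eval v (R2 i) M = eval v (R i) M" for i
      by (rule eval_cong; use assms(1) StoreIf 1(2) 2(2) in auto)+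
    have "R3 i 65 = eval g (V i) M" "R3 i 66 = eval a (V i) M" "R3 i 67 = eval v (V i) M" for i
      using 1(2) 2(2) 3(2) e ev[of g] ev[of a] ev[of v] assms(1) StoreIf by simp_all
    then have "fold (guarded_step P) (cmd_code c) (R, M) = (R3, M')"
      using 1(1) 2(1) 3(1) assms(4) by (auto simp: StoreIf fun_eq_iff cong: if_cong)
    moreover have "V' = V" using assms(4) StoreIf by simp
    moreover have "sim q R3 V"
      using 1(2) 2(2) 3(2) assms(2) by (simp add: sim_def)
    ultimately show ?thesis using assms(3) by blast
  qed
qed

definition cmds_code :: "cmd list \<Rightarrow> (nat \<times> instr) list" where
  "cmds_code cs = concat (map cmd_code cs)"

lemma cmds_code_correct:
  assumes "\<forall>c\<in>set cs. wf_cmd c" and "sim q R V" and "consts_ok L V"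
    and "fold (cmd_sem P) cs (V, M) = (V', M')"
  shows "\<exists>R'. fold (guarded_step P) (cmds_code cs) (R, M) = (R', M') \<and> sim q R' V' \<and> consts_ok L V'"
  using assms
proof (induction cs arbitrary: R V M)
  case Nil
  then show ?case by (auto simp: cmds_code_def)
next
  case (Cons c cs)
  obtain V1 M1 where s: "cmd_sem P c (V, M) = (V1, M1)" by force
  obtain R1 where 1: "fold (guarded_step P) (cmd_code c) (R, M) = (R1, M1)"
      "sim q R1 V1" "consts_ok L V1"
    using cmd_code_correct[OF _ Cons.prems(2,3) s] Cons.prems(1) by auto
  obtain R2 where "fold (guarded_step P) (cmds_code cs) (R1, M1) = (R2, M')"
      "sim q R2 V'" "consts_ok L V'"
    using Cons.IH[of R1 V1 M1] Cons.prems s 1 by auto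
  with 1 show ?case by (auto simp: cmds_code_def)
qed

lemma cmds_run:
  assumes "prog = pre @ block_code pc (cmds_code cs) @ post" and "length pre = pc"
    and "\<forall>c\<in>set cs. wf_cmd c" and "sim q R V" and "consts_ok L V"
    and "fold (cmd_sem P) cs (V, M) = (V', M')"
  shows "\<exists>R'. (pram_step prog P ^^ (3 * length (cmds_code cs))) (\<lambda>i. (pc, R i), M)
           = (\<lambda>i. (pc + 5 * length (cmds_code cs), R' i), M') \<and> sim q R' V' \<and> consts_ok L V'"
proof -
  obtain R' where "fold (guarded_step P) (cmds_code cs) (R, M) = (R', M')"
      "sim q R' V'" "consts_ok L V'"
    using cmds_code_correct[OF assms(3-6)] by auto
  moreover have "\<forall>x\<in>set (cmds_code cs). keeps_zero (snd x)"
    using assms(3) cmd_code_keeps_zero by (auto simp: cmds_code_def)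
  moreover have "\<forall>i. R i 2 = 0"
    using assms(4,5) by (auto simp: sim_def consts_ok_def)
  ultimately show ?thesis
    using block_code_run[OF assms(1,2)] by blast
qed

section \<open>Binary length and loops\<close>

text \<open>The number of binary digits, defined by halving because this is how often a loop runs
  whose counter is halved until it is zero.\<close>

fun nbits :: "nat \<Rightarrow> nat" where
  "nbits q = (if q = 0 then 0 else Suc (nbits (q div 2)))"

declare nbits.simps [simp del]

lemma nbits_0 [simp]: "nbits 0 = 0"
  by (simp add: nbits.simps)

lemma nbits_pos: "0 < q \<Longrightarrow> nbits q = Suc (nbits (q div 2))"
  by (subst nbits.simps) simp

lemma less_power_nbits: "q < 2 ^ nbits q"
proof (induction q rule: nbits.induct)
  case (1 q)
  then show ?case by (cases "q = 0") (auto simp: nbits_pos)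
qed

lemma power_nbits_le: "2 ^ nbits q \<le> 2 * q + 1"
proof (induction q rule: nbits.induct)
  case (1 q)
  show ?case
  proof (cases "q = 0 \<or> q = 1")
    case True
    then show ?thesis by (auto simp: nbits_pos)
  next
    case False
    \<comment> \<open>Doubling the induction hypothesis directly would exceed the claim by one. A
      power of two with positive exponent is even, which improves the bound
      \<open>2 * (q div 2) + 1\<close> to \<open>2 * (q div 2)\<close>.\<close>
    have "even (2 ^ nbits (q div 2) :: nat)"
      using False by (simp add: nbits_pos div_greater_zero_iff)
    moreover have "2 ^ nbits (q div 2) \<le> 2 * (q div 2) + 1"
      using 1 False by simp
    ultimately have "2 ^ nbits (q div 2) \<le> 2 * (q div 2)"
      by presburger
    then show ?thesis using False by (auto simp: nbits_pos)
  qed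
qed

lemma nbits_le_floor_log: "nbits q \<le> Suc (floor_log q)"
proof (induction q rule: nbits.induct)
  case (1 q)
  show ?case
  proof (cases "q < 2")
    case True
    then have "q = 0 \<or> q = 1" by auto
    then show ?thesis by (auto simp: nbits_pos)
  next
    case False
    have "nbits q = Suc (nbits (q div 2))" by (rule nbits_pos) (use False in simp)
    moreover have "floor_log q = Suc (floor_log (q div 2))" by (rule floor_log_rec) (use False in simp)
    ultimately show ?thesis using 1 False by simp
  qed
qed

text \<open>Control flow is reduced to straight code and loops with one common number of rounds, so
  processors never disagree about leaving a loop.\<close>

datatype stage = Once "cmd list" | Loop "cmd list"

fun stage_cmds :: "stage \<Rightarrow> cmd list" where
  "stage_cmds (Once cs) = cs"
| "stage_cmds (Loop cs) = cs"

fun stage_sem :: "nat \<Rightarrow> nat \<Rightarrow> stage \<Rightarrow> simd \<Rightarrow> simd" where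
  "stage_sem P K (Once cs) = fold (cmd_sem P) cs"
| "stage_sem P K (Loop cs) = fold (cmd_sem P) cs ^^ K"

text \<open>The loop counter in register 64 starts as the input length. The exit address skips two
  header instructions, five per instruction of the body, and two closing ones.\<close>

fun stage_code :: "nat \<Rightarrow> stage \<Rightarrow> instr list" where
  "stage_code pc (Once cs) = block_code pc (cmds_code cs)"
| "stage_code pc (Loop cs) =
     [Add 64 1 2, JumpZero 64 (pc + 5 * length (cmds_code cs) + 4)] @
     block_code (pc + 2) (cmds_code cs) @ [Half 64 64, JumpZero 2 (pc + 1)]"

text \<open>The three additional steps of a round are the loop test, the halving and the jump
  back.\<close>

definition stage_cost :: "stage \<Rightarrow> nat" where
  "stage_cost s = 3 * length (cmds_code (stage_cmds s)) + 3"

lemma pram_step_uniform: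
  assumes "pc < length prog" and "\<And>r s. prog ! pc \<noteq> Store r s"
  shows "pram_step prog P (\<lambda>i. (pc, R i), M) = (\<lambda>i. exec_instr M (prog ! pc) (pc, R i), M)"
proof -
  have "proc_write prog (pc, R i) = None" for i
    using assms(2) by (auto simp: proc_write_def split: instr.split)
  then show ?thesis
    using assms(1) by (simp add: mem_step_no_write proc_step_def halted_def pram_step.simps)
qed

text \<open>Execution starts at \<open>pc + 1\<close>, behind the initialisation of the counter, so
  that the induction hypothesis applies after each jump back. The final \<open>+ 1\<close> in the
  number of steps is the test that exits.\<close>

lemma loop_run:
  assumes prog: "prog = pre @ stage_code pc (Loop cs) @ post" and pc: "length pre = pc"
    and wf: "\<forall>c\<in>set cs. wf_cmd c"
    and "sim q R V" and "consts_ok L V"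
    and "(fold (cmd_sem P) cs ^^ nbits q) (V, M) = (V', M')"
  shows "\<exists>R'. (pram_step prog P ^^ (nbits q * stage_cost (Loop cs) + 1)) (\<lambda>i. (pc + 1, R i), M)
           = (\<lambda>i. (pc + length (stage_code pc (Loop cs)), R' i), M') \<and> sim 0 R' V' \<and> consts_ok L V'"
  using assms(4-)
proof (induction q arbitrary: R V M rule: nbits.induct)
  case (1 q)
  let ?b = "5 * length (cmds_code cs)"
  note nth = nth_code_segment[OF prog pc]
  have p: "prog ! (pc + 1) = JumpZero 64 (pc + ?b + 4)" "prog ! (pc + 2 + ?b) = Half 64 64"
    "prog ! (pc + 3 + ?b) = JumpZero 2 (pc + 1)" "pc + 3 + ?b < length prog"
    using nth[of 1] nth[of "2 + ?b"] nth[of "3 + ?b"]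
    by (simp_all add: nth_append numeral_eq_Suc)
  have 64: "R i 64 = q" for i using "1.prems" by (simp add: sim_def)
  show ?case
  proof (cases "q = 0")
    case True
    have "pram_step prog P (\<lambda>i. (pc + 1, R i), M) = (\<lambda>i. (pc + ?b + 4, R i), M)"
      using p 64 True by (subst pram_step_uniform) auto
    moreover have "pc + length (stage_code pc (Loop cs)) = pc + ?b + 4" by simp
    ultimately have "(pram_step prog P ^^ (nbits q * stage_cost (Loop cs) + 1)) (\<lambda>i. (pc + 1, R i), M)
        = (\<lambda>i. (pc + length (stage_code pc (Loop cs)), R i), M)"
      using True by (simp add: add.assoc del: stage_code.simps)
    then show ?thesis using 1 True by auto
  next
    case False
    obtain V1 M1 where s: "fold (cmd_sem P) cs (V, M) = (V1, M1)" by force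
    have a: "(pram_step prog P ^^ 1) (\<lambda>i. (pc + 1, R i), M) = (\<lambda>i. (pc + 2, R i), M)"
      using p 64 False by (simp, subst pram_step_uniform) auto
    have "\<exists>R1. (pram_step prog P ^^ (3 * length (cmds_code cs))) (\<lambda>i. (pc + 2, R i), M)
        = (\<lambda>i. (pc + 2 + ?b, R1 i), M1) \<and> sim q R1 V1 \<and> consts_ok L V1"
    proof (rule cmds_run[OF _ _ wf "1.prems"(1,2) s])
      show "prog = (pre @ [Add 64 1 2, JumpZero 64 (pc + ?b + 4)]) @
        block_code (pc + 2) (cmds_code cs) @ [Half 64 64, JumpZero 2 (pc + 1)] @ post"
        using prog by simp
    qed (use pc in simp)
    then obtain R1 where
      b: "(pram_step prog P ^^ (3 * length (cmds_code cs))) (\<lambda>i. (pc + 2, R i), M)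
        = (\<lambda>i. (pc + 2 + ?b, R1 i), M1)" and R1: "sim q R1 V1" "consts_ok L V1"
      by blast
    define R2 where "R2 = (\<lambda>i. (R1 i)(64 := q div 2))"
    have R1': "R1 i 64 = q" "R1 i 2 = 0" for i using R1 by (auto simp: sim_def consts_ok_def)
    have c1: "pram_step prog P (\<lambda>i. (pc + 2 + ?b, R1 i), M1) = (\<lambda>i. (pc + 3 + ?b, R2 i), M1)"
      using p R1' by (subst pram_step_uniform) (auto simp: R2_def)
    have c2: "pram_step prog P (\<lambda>i. (pc + 3 + ?b, R2 i), M1) = (\<lambda>i. (pc + 1, R2 i), M1)"
      using p R1' by (subst pram_step_uniform) (auto simp: R2_def)
    have c: "(pram_step prog P ^^ 2) (\<lambda>i. (pc + 2 + ?b, R1 i), M1) = (\<lambda>i. (pc + 1, R2 i), M1)"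
      using c1 c2 by (simp add: numeral_2_eq_2)
    have "sim (q div 2) R2 V1" using R1 by (auto simp: sim_def R2_def)
    moreover have "(fold (cmd_sem P) cs ^^ nbits (q div 2)) (V1, M1) = (V', M')"
      using "1.prems"(3) False s by (simp add: nbits_pos funpow_swap1)
    ultimately obtain R' where d: "(pram_step prog P ^^ (nbits (q div 2) * stage_cost (Loop cs) + 1))
        (\<lambda>i. (pc + 1, R2 i), M1) = (\<lambda>i. (pc + length (stage_code pc (Loop cs)), R' i), M')"
        and "sim 0 R' V'" "consts_ok L V'"
      using "1.IH"[OF False _ R1(2)] by blast
    moreover have "nbits q * stage_cost (Loop cs) + 1
        = 1 + 3 * length (cmds_code cs) + 2 + (nbits (q div 2) * stage_cost (Loop cs) + 1)"
      using False by (simp add: nbits_pos stage_cost_def)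
    then have "(pram_step prog P ^^ (nbits q * stage_cost (Loop cs) + 1)) (\<lambda>i. (pc + 1, R i), M)
      = (\<lambda>i. (pc + length (stage_code pc (Loop cs)), R' i), M')"
      using funpow_add_apply[OF funpow_add_apply[OF funpow_add_apply[OF a b] c] d] by simp
    ultimately show ?thesis by blast
  qed
qed

lemma stage_run:
  assumes prog: "prog = pre @ stage_code pc s @ post" and pc: "length pre = pc"
    and wf: "\<forall>c\<in>set (stage_cmds s). wf_cmd c"
    and sim: "sim 0 R V" and ok: "consts_ok L V"
    and sem: "stage_sem P (nbits L) s (V, M) = (V', M')"
  shows "\<exists>R' t. t \<le> (nbits L + 1) * stage_cost s \<and> (pram_step prog P ^^ t) (\<lambda>i. (pc, R i), M)
           = (\<lambda>i. (pc + length (stage_code pc s), R' i), M') \<and> sim 0 R' V' \<and> consts_ok L V'"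
proof (cases s)
  case (Once cs)
  obtain R' where "(pram_step prog P ^^ (3 * length (cmds_code cs))) (\<lambda>i. (pc, R i), M)
           = (\<lambda>i. (pc + 5 * length (cmds_code cs), R' i), M')" "sim 0 R' V'" "consts_ok L V'"
    using cmds_run[OF _ pc _ sim ok] prog wf sem Once by fastforce
  moreover have "3 * length (cmds_code cs) \<le> (nbits L + 1) * stage_cost s"
    by (simp add: Once stage_cost_def)
  ultimately show ?thesis using Once by auto
next
  case (Loop cs)
  have p: "prog ! pc = Add 64 1 2" "pc < length prog"
    using nth_code_segment[OF prog pc, of 0] by (simp_all add: Loop)
  define R1 where "R1 = (\<lambda>i. (R i)(64 := L))"
  have "R i 1 = L" "R i 2 = 0" for i using sim ok by (auto simp: sim_def consts_ok_def)
  then have a: "(pram_step prog P ^^ 1) (\<lambda>i. (pc, R i), M) = (\<lambda>i. (pc + 1, R1 i), M)"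
    using p by (simp, subst pram_step_uniform) (auto simp: R1_def)
  have "sim L R1 V" using sim by (auto simp: sim_def R1_def)
  then obtain R' where b: "(pram_step prog P ^^ (nbits L * stage_cost (Loop cs) + 1)) (\<lambda>i. (pc + 1, R1 i), M)
           = (\<lambda>i. (pc + length (stage_code pc (Loop cs)), R' i), M')"
           and "sim 0 R' V'" "consts_ok L V'"
    using loop_run[OF _ pc _ _ ok] prog wf sem Loop by fastforce
  \<comment> \<open>Setting the counter and the exit test take two steps, which the cost of one
    further round pays for.\<close>
  moreover have "1 + (nbits L * stage_cost (Loop cs) + 1) \<le> (nbits L + 1) * stage_cost s"
    by (simp add: Loop stage_cost_def)
  ultimately show ?thesis
    using funpow_add_apply[OF a b] Loop by blast
qed

fun stages_code :: "nat \<Rightarrow> stage list \<Rightarrow> instr list" where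
  "stages_code pc [] = []"
| "stages_code pc (s # ss) = stage_code pc s @ stages_code (pc + length (stage_code pc s)) ss"

lemma stages_run:
  assumes "prog = pre @ stages_code pc ss @ post" and "length pre = pc"
    and "\<forall>s\<in>set ss. \<forall>c\<in>set (stage_cmds s). wf_cmd c"
    and "sim 0 R V" and "consts_ok L V"
    and "fold (stage_sem P (nbits L)) ss (V, M) = (V', M')"
  shows "\<exists>R' t. t \<le> (nbits L + 1) * sum_list (map stage_cost ss) \<and>
           (pram_step prog P ^^ t) (\<lambda>i. (pc, R i), M)
             = (\<lambda>i. (pc + length (stages_code pc ss), R' i), M')"
  using assms
proof (induction ss arbitrary: pc pre R V M)
  case Nil
  then show ?case by (auto intro!: exI[of _ 0])
next
  case (Cons s ss)
  obtain V1 M1 where s: "stage_sem P (nbits L) s (V, M) = (V1, M1)" by force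
  have "prog = pre @ stage_code pc s @ (stages_code (pc + length (stage_code pc s)) ss @ post)"
    using Cons.prems by simp
  from stage_run[OF this Cons.prems(2) _ Cons.prems(4,5) s] Cons.prems(3)
  obtain R1 t1 where 1: "t1 \<le> (nbits L + 1) * stage_cost s"
    "(pram_step prog P ^^ t1) (\<lambda>i. (pc, R i), M) = (\<lambda>i. (pc + length (stage_code pc s), R1 i), M1)"
    "sim 0 R1 V1" "consts_ok L V1"
    by auto
  have "\<exists>R' t. t \<le> (nbits L + 1) * sum_list (map stage_cost ss) \<and>
       (pram_step prog P ^^ t) (\<lambda>i. (pc + length (stage_code pc s), R1 i), M1)
         = (\<lambda>i. (pc + length (stage_code pc s)
             + length (stages_code (pc + length (stage_code pc s)) ss), R' i), M')"
    by (rule Cons.IH[of "pre @ stage_code pc s"]) (use Cons.prems 1 s in auto)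
  then obtain R' t2 where 2: "t2 \<le> (nbits L + 1) * sum_list (map stage_cost ss)"
    "(pram_step prog P ^^ t2) (\<lambda>i. (pc + length (stage_code pc s), R1 i), M1)
         = (\<lambda>i. (pc + length (stage_code pc s)
             + length (stages_code (pc + length (stage_code pc s)) ss), R' i), M')"
    by blast
  have "t1 + t2 \<le> (nbits L + 1) * sum_list (map stage_cost (s # ss))"
    using 1 2 by (simp add: algebra_simps)
  then show ?case
    using funpow_add_apply[OF 1(2) 2(2)] by (auto simp: add.assoc)
qed

text \<open>The state after the single instruction \<open>Const 3 1\<close>, which installs the
  constant needed by the always-true guard.\<close>

definition simd_init :: "bool list \<Rightarrow> simd" where
  "simd_init w = (\<lambda>i. (\<lambda>_. 0)(0 := i, 1 := length w, 3 := 1), snd (pram_init w))"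

text \<open>The code does not depend on the word, and halting means running off its end. By
  \<open>nbits L \<le> floor_log L + 1\<close>, the bound \<open>(nbits L + 1) * C + 1\<close> on
  the steps is at most a linear polynomial in \<open>floor_log L\<close>.\<close>

theorem NC_I:
  assumes wf: "\<forall>s\<in>set ss. \<forall>c\<in>set (stage_cmds s). wf_cmd c"
    and sem: "\<And>w. snd (fold (stage_sem (poly procs (length w)) (nbits (length w))) ss (simd_init w)) 0 = 1
                \<longleftrightarrow> w \<in> A"
  shows "A \<in> NC"
proof -
  define prog where "prog = Const 3 1 # stages_code 1 ss"
  define C where "C = sum_list (map stage_cost ss)"
  have "\<exists>t S M. t \<le> poly [:2 * C + 1, C:] (floor_log (length w)) \<and>
          pram_run prog (poly procs (length w)) w t = (S, M) \<and>
          (\<forall>i < poly procs (length w). halted prog (S i)) \<and> (M 0 = 1 \<longleftrightarrow> w \<in> A)" for w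
  proof -
    let ?P = "poly procs (length w)" and ?L = "length w"
    define V where "V = fst (simd_init w)"
    define M where "M = snd (pram_init w)"
    obtain V' M' where r: "fold (stage_sem ?P (nbits ?L)) ss (V, M) = (V', M')" by force
    have init: "pram_step prog ?P (pram_init w) = (\<lambda>i. (1, V i), M)"
      using pram_step_uniform[of 0 prog ?P "\<lambda>i. (\<lambda>_. 0)(0 := i, 1 := length w)" M]
      by (simp add: pram_init_def prog_def V_def M_def simd_init_def)
    obtain R' t where t: "t \<le> (nbits ?L + 1) * C"
        "(pram_step prog ?P ^^ t) (\<lambda>i. (1, V i), M) = (\<lambda>i. (1 + length (stages_code 1 ss), R' i), M')"
      using stages_run[of prog "[Const 3 1]" 1 ss "[]" V V ?L ?P M V' M'] wf r
      by (auto simp: prog_def C_def sim_def consts_ok_def V_def simd_init_def)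
    have "pram_run prog ?P w (Suc t) = (\<lambda>i. (1 + length (stages_code 1 ss), R' i), M')"
      using t init by (simp add: pram_run_def funpow_swap1)
    moreover have "Suc t \<le> poly [:2 * C + 1, C:] (floor_log ?L)"
    proof -
      have "(nbits ?L + 1) * C \<le> (floor_log ?L + 2) * C"
        using nbits_le_floor_log[of ?L] by (intro mult_right_mono) auto
      then show ?thesis using t(1) by (simp add: algebra_simps)
    qed
    moreover have "M' 0 = 1 \<longleftrightarrow> w \<in> A"
      using sem[of w] r by (simp add: V_def M_def simd_init_def)
    ultimately show ?thesis
      by (intro exI[of _ "Suc t"]) (auto simp: halted_def prog_def)
  qed
  then show ?thesis unfolding NC_def by blast
qed

section \<open>Activation along quiet paths\<close>

definition active_count :: "('c \<Rightarrow> 'c set) \<Rightarrow> ('c \<Rightarrow> bool) \<Rightarrow> 'c \<Rightarrow> nat" where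
  "active_count N x u = (\<Sum>w\<in>N u. of_bool (x w))"

text \<open>Edges point against the spread of activity: \<open>d\<close> is a neighbour whose
  activation could trigger the inactive cell \<open>c\<close>.\<close>

definition quiet_edges :: "'c set \<Rightarrow> ('c \<Rightarrow> 'c set) \<Rightarrow> ('c \<Rightarrow> bool) \<Rightarrow> ('c \<times> 'c) set" where
  "quiet_edges G N x = {(c, d). c \<in> G \<and> \<not> x c \<and> active_count N x c = 0 \<and> d \<in> N c}"

definition can_fire :: "('c \<Rightarrow> 'c set) \<Rightarrow> nat \<Rightarrow> nat \<Rightarrow> ('c \<Rightarrow> bool) \<Rightarrow> 'c \<Rightarrow> bool" where
  "can_fire N k1 k2 x v \<longleftrightarrow> \<not> x v \<and> active_count N x v \<in> {k1..k2}"

lemma lifelike_freezing_iff: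
  "lifelike_freezing N k1 k2 x u \<longleftrightarrow> x u \<or> active_count N x u \<in> {k1..k2}"
  by (simp add: lifelike_freezing_def active_count_def)

lemma active_count_eq_0_iff:
  "finite (N u) \<Longrightarrow> active_count N x u = 0 \<longleftrightarrow> (\<forall>w\<in>N u. \<not> x w)"
  by (auto simp: active_count_def)

lemma active_count_mono:
  "(\<And>w. x w \<Longrightarrow> y w) \<Longrightarrow> active_count N x u \<le> active_count N y u"
  unfolding active_count_def by (intro sum_mono) (auto simp: of_bool_def)

lemma seq_iterate_mono:
  "x w \<Longrightarrow> seq_iterate (lifelike_freezing N k1 k2) \<sigma> x t w"
  by (induction t) (auto simp: Let_def lifelike_freezing_def)

text \<open>Causes are traced backwards in time: a cell that could not fire at the start must have
  gained an active neighbour earlier, to which the induction hypothesis applies.\<close>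

lemma quiet_path_if_activated:
  assumes fin: "finite G" and N: "\<And>c. c \<in> G \<Longrightarrow> N c \<subseteq> G" and k1: "k1 \<le> 1" and u: "u \<in> G"
    and act: "seq_iterate (lifelike_freezing N k1 k2) \<sigma> x t u" "\<not> x u"
  shows "\<exists>v. (u, v) \<in> (quiet_edges G N x)\<^sup>* \<and> can_fire N k1 k2 x v"
  using u act
proof (induction t arbitrary: u)
  case 0
  then show ?case by simp
next
  case (Suc t)
  define y where "y = seq_iterate (lifelike_freezing N k1 k2) \<sigma> x t"
  show ?case
  proof (cases "y u")
    case True
    then show ?thesis using Suc by (simp add: y_def)
  next
    case False
    have "(y(\<sigma> t := lifelike_freezing N k1 k2 y (\<sigma> t))) u"
      using Suc.prems(2) by (simp add: y_def Let_def)
    then have c: "active_count N y u \<in> {k1..k2}"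
      using False unfolding lifelike_freezing_iff by (simp split: if_splits)
    have le: "active_count N x u \<le> active_count N y u"
      by (rule active_count_mono) (simp add: y_def seq_iterate_mono)
    show ?thesis
    proof (cases "can_fire N k1 k2 x u")
      case True
      then show ?thesis by blast
    next
      case False
      \<comment> \<open>Counts only grow, so the initial one is at most \<open>k2\<close>. Being
        outside the interval, it lies below \<open>k1 \<le> 1\<close> and is zero.\<close>
      then have z: "active_count N x u = 0" "k1 = 1"
        using c le k1 Suc.prems(3) by (auto simp: can_fire_def)
      have finN: "finite (N u)" using N[OF Suc.prems(1)] fin finite_subset by blast
      obtain w where w: "w \<in> N u" "y w"
        using active_count_eq_0_iff[of N u y] finN c z by auto
      have "\<not> x w" using w z finN by (auto simp: active_count_eq_0_iff)
      then obtain v where "(w, v) \<in> (quiet_edges G N x)\<^sup>*" "can_fire N k1 k2 x v"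
        using Suc.IH[of w] w N[OF Suc.prems(1)] by (auto simp: y_def)
      moreover have "(u, w) \<in> quiet_edges G N x"
        using w z Suc.prems by (simp add: quiet_edges_def)
      ultimately show ?thesis by (meson converse_rtrancl_into_rtrancl)
    qed
  qed
qed

text \<open>The prefix is completed to an enumeration of \<open>G\<close>, which is repeated
  periodically.\<close>

lemma scheme_with_prefix:
  assumes fin: "finite G" and ps: "distinct ps" "set ps \<subseteq> G" "ps \<noteq> []"
  shows "\<exists>\<sigma>. sequential_scheme G \<sigma> \<and> (\<forall>t<length ps. \<sigma> t = ps ! t)"
proof -
  obtain qs where qs: "set qs = G - set ps" "distinct qs"
    using finite_distinct_list fin by blast
  define rs where "rs = ps @ qs"
  have rs: "distinct rs" "set rs = G" using ps qs by (auto simp: rs_def)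
  have len: "length rs = card G" using rs distinct_card by fastforce
  define \<sigma> where "\<sigma> t = rs ! (t mod card G)" for t
  have pos: "0 < card G" using ps fin by (metis card_gt_0_iff set_empty subset_empty)
  have "bij_betw \<sigma> {b * card G ..< Suc b * card G} G" for b
  proof -
    have "bij_betw (\<lambda>t. t - b * card G) {b * card G ..< Suc b * card G} {..<card G}"
      by (rule bij_betw_byWitness[where f' = "\<lambda>t. t + b * card G"]) auto
    moreover have "bij_betw (nth rs) {..<card G} G"
      using rs len bij_betw_nth by metis
    ultimately have "bij_betw (nth rs \<circ> (\<lambda>t. t - b * card G)) {b * card G ..< Suc b * card G} G"
      by (rule bij_betw_trans)
    moreover have "(nth rs \<circ> (\<lambda>t. t - b * card G)) t = \<sigma> t"
      if "t \<in> {b * card G ..< Suc b * card G}" for t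
    proof -
      define r where "r = t - b * card G"
      have "t = b * card G + r" "r < card G"
        using that by (auto simp: r_def)
      then show ?thesis by (simp add: \<sigma>_def)
    qed
    ultimately show ?thesis
      using bij_betw_cong[of "{b * card G ..< Suc b * card G}" "nth rs \<circ> (\<lambda>t. t - b * card G)" \<sigma> G]
      by blast
  qed
  moreover have "\<sigma> t = ps ! t" if "t < length ps" for t
    using that len by (simp add: \<sigma>_def rs_def nth_append)
  ultimately show ?thesis by (auto simp: sequential_scheme_def)
qed

text \<open>Minimality of the path, taken over all endpoints that can fire, is used twice. It makes
  the cells distinct, so that they form a prefix of a scheme, and it excludes shortcuts, so that no
  cell sees a second active cell of the path.\<close>

lemma unstable_if_quiet_path:
  assumes fin: "finite G" and N: "\<And>c. c \<in> G \<Longrightarrow> N c \<subseteq> G" and k1: "k1 \<le> 1" "1 \<le> k2"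
    and u: "u \<in> G" and path: "(u, v) \<in> (quiet_edges G N x)\<^sup>*" and v: "can_fire N k1 k2 x v"
  shows "async_unstable G (lifelike_freezing N k1 k2) x u"
proof -
  let ?E = "quiet_edges G N x" and ?F = "lifelike_freezing N k1 k2"
  let ?Q = "\<lambda>m. \<exists>v. (u, v) \<in> ?E ^^ m \<and> can_fire N k1 k2 x v"
  define m where "m = (LEAST m. ?Q m)"
  have "\<exists>m. ?Q m" using path v by (meson rtrancl_imp_relpow)
  then have Qm: "?Q m" unfolding m_def by (rule LeastI_ex)
  have min: "m \<le> l" if "(u, v) \<in> ?E ^^ l" "can_fire N k1 k2 x v" for l v
    unfolding m_def using that by (auto intro: Least_le)
  obtain f where f: "f 0 = u" "can_fire N k1 k2 x (f m)" "\<And>i. i < m \<Longrightarrow> (f i, f (Suc i)) \<in> ?E"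
    using Qm by (auto simp: relpow_fun_conv)
  have pre: "(u, f i) \<in> ?E ^^ i" if "i \<le> m" for i
    using that f by (auto simp: relpow_fun_conv intro!: exI[of _ f])
  have post: "(f i, f m) \<in> ?E ^^ (m - i)" if "i \<le> m" for i
    using that f by (auto simp: relpow_fun_conv intro!: exI[of _ "\<lambda>k. f (i + k)"])
  have fG: "f i \<in> G" if "i \<le> m" for i
  proof (cases i)
    case 0
    then show ?thesis using u f by simp
  next
    case (Suc j)
    then have "(f j, f i) \<in> ?E" using f that by simp
    then show ?thesis using N by (auto simp: quiet_edges_def)
  qed
  \<comment> \<open>If a cell occurred twice, the cycle between its occurrences could be cut
    out.\<close>
  have neq: "f i \<noteq> f l" if "i < l" "l \<le> m" for i l
  proof
    assume "f i = f l"
    then have "(u, f m) \<in> ?E ^^ (i + (m - l))"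
      using pre[of i] post[of l] that unfolding relpow_add by auto
    from min[OF this f(2)] that show False by simp
  qed
  \<comment> \<open>An edge that skips cells of the path would shorten it.\<close>
  have edge: "l = Suc i" if "i < l" "l \<le> m" "(f i, f l) \<in> ?E" for i l
  proof -
    have "(u, f l) \<in> ?E ^^ Suc i" using pre[of i] that by auto
    then have "(u, f m) \<in> ?E ^^ (Suc i + (m - l))"
      using post[of l] that unfolding relpow_add by blast
    from min[OF this f(2)] that show ?thesis by simp
  qed
  have inj: "inj_on f {..m}"
    using neq by (intro inj_onI) (metis atMost_iff nat_neq_iff)
  define ps where "ps = map (\<lambda>t. f (m - t)) [0..<Suc m]"
  have "inj_on (\<lambda>t. f (m - t)) {0..<Suc m}"
  proof (rule inj_onI)
    fix s t
    assume *: "s \<in> {0..<Suc m}" "t \<in> {0..<Suc m}" "f (m - s) = f (m - t)"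
    then have "m - s = m - t" using inj_onD[OF inj, of "m - s" "m - t"] by simp
    with * show "s = t" by auto
  qed
  then have "distinct ps"
    unfolding ps_def distinct_map by (simp del: upt_Suc)
  moreover have "set ps \<subseteq> G" using fG by (auto simp: ps_def)
  ultimately obtain \<sigma> where \<sigma>: "sequential_scheme G \<sigma>" "\<And>t. t \<le> m \<Longrightarrow> \<sigma> t = f (m - t)"
    using scheme_with_prefix[OF fin, of ps] by (auto simp: ps_def nth_append less_Suc_eq_le)
  \<comment> \<open>After \<open>t\<close> updates the last \<open>t\<close> cells of the path are
    active; \<open>m < i + t\<close> says so without truncated subtraction.\<close>
  have state: "seq_iterate ?F \<sigma> x t = (\<lambda>c. x c \<or> (\<exists>i. m < i + t \<and> i \<le> m \<and> c = f i))" if "t \<le> Suc m" for t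
    using that
  proof (induction t)
    case 0
    then show ?case by auto
  next
    case (Suc t)
    let ?y = "seq_iterate ?F \<sigma> x t"
    define i where "i = m - t"
    have i: "i + t = m" "i \<le> m" using Suc.prems by (auto simp: i_def)
    have le_iff: "i \<le> l \<longleftrightarrow> m < l + Suc t" for l using i(1) by auto
    have y: "?y = (\<lambda>c. x c \<or> (\<exists>l. i < l \<and> l \<le> m \<and> c = f l))"
      using Suc i by (auto simp: fun_eq_iff)
    have "active_count N ?y (f i) \<in> {k1..k2}"
    proof (cases "i = m")
      case True
      then have "?y = x" using y by auto
      then show ?thesis using f(2) True by (simp add: can_fire_def)
    next
      case False
      then have e: "(f i, f (Suc i)) \<in> ?E" using f(3) i by simp
      then have q: "active_count N x (f i) = 0" "f (Suc i) \<in> N (f i)" "\<not> x (f i)"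
        by (auto simp: quiet_edges_def)
      have fN: "finite (N (f i))" using N[OF fG[OF i(2)]] fin finite_subset by blast
      have "?y w \<longleftrightarrow> w = f (Suc i)" if "w \<in> N (f i)" for w
      proof -
        \<comment> \<open>Every neighbour of the quiet cell \<open>f i\<close> is the end of an
          edge, so by \<open>edge\<close> the only later path cell among them is the next
          one.\<close>
        have "(f i, w) \<in> ?E" using that q fG[OF i(2)] by (simp add: quiet_edges_def)
        moreover have "\<not> x w" using q(1) fN that by (simp add: active_count_eq_0_iff)
        ultimately show ?thesis using edge[of i] False i unfolding y by fastforce
      qed
      then have "active_count N ?y (f i) = (\<Sum>w\<in>N (f i). if w = f (Suc i) then 1 else 0)"
        unfolding active_count_def by (intro sum.cong) auto
      also have "\<dots> = 1" using q fN by simp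
      finally show ?thesis using k1 by simp
    qed
    then have "?F ?y (f i)" by (simp add: lifelike_freezing_iff)
    moreover have "\<sigma> t = f i" using \<sigma>(2) Suc.prems i by (simp add: i_def)
    ultimately have "seq_iterate ?F \<sigma> x (Suc t) = ?y(f i := True)"
      by (simp add: Let_def)
    also have "\<dots> = (\<lambda>c. x c \<or> (\<exists>l. i \<le> l \<and> l \<le> m \<and> c = f l))"
      unfolding y using i(2) by (auto simp: fun_eq_iff le_less)
    also have "(\<lambda>c. x c \<or> (\<exists>l. i \<le> l \<and> l \<le> m \<and> c = f l))
        = (\<lambda>c. x c \<or> (\<exists>l. m < l + Suc t \<and> l \<le> m \<and> c = f l))"
      using le_iff by simp
    finally show ?case .
  qed
  have "seq_iterate ?F \<sigma> x (Suc m) u"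
    using state[of "Suc m"] f(1) by auto
  moreover have "\<not> x u"
    using f by (cases m) (auto simp: can_fire_def quiet_edges_def)
  ultimately show ?thesis
    unfolding async_unstable_def using \<sigma>(1) by (metis zero_less_Suc)
qed

theorem async_unstable_iff_quiet_path:
  assumes "finite G" and "\<And>c. c \<in> G \<Longrightarrow> N c \<subseteq> G" and "k1 \<le> 1" and "1 \<le> k2" and "u \<in> G"
  shows "async_unstable G (lifelike_freezing N k1 k2) x u \<longleftrightarrow>
           (\<exists>v. (u, v) \<in> (quiet_edges G N x)\<^sup>* \<and> can_fire N k1 k2 x v)"
proof
  assume "async_unstable G (lifelike_freezing N k1 k2) x u"
  then obtain \<sigma> T where T: "seq_iterate (lifelike_freezing N k1 k2) \<sigma> x T u \<noteq> x u"
    by (auto simp: async_unstable_def)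
  then have "seq_iterate (lifelike_freezing N k1 k2) \<sigma> x T u" "\<not> x u"
    using seq_iterate_mono by metis+
  then show "\<exists>v. (u, v) \<in> (quiet_edges G N x)\<^sup>* \<and> can_fire N k1 k2 x v"
    using quiet_path_if_activated[of G N k1 u k2 \<sigma> x T] assms by blast
next
  assume "\<exists>v. (u, v) \<in> (quiet_edges G N x)\<^sup>* \<and> can_fire N k1 k2 x v"
  then show "async_unstable G (lifelike_freezing N k1 k2) x u"
    using unstable_if_quiet_path[of G N k1 k2 u _ x] assms by blast
qed

section \<open>Transitive closure in parallel\<close>

definition e_not :: "exp \<Rightarrow> exp" where "e_not a = IfNZ a (Lit 0) (Lit 1)"
definition e_and :: "exp \<Rightarrow> exp \<Rightarrow> exp" where "e_and a b = IfNZ a (IfNZ b (Lit 1) (Lit 0)) (Lit 0)"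
definition e_less :: "exp \<Rightarrow> exp \<Rightarrow> exp" where "e_less a b = IfNZ (Minus b a) (Lit 1) (Lit 0)"
definition e_eq :: "exp \<Rightarrow> exp \<Rightarrow> exp" where "e_eq a b = e_not (Plus (Minus a b) (Minus b a))"
definition e_dbl :: "exp \<Rightarrow> exp" where "e_dbl a = Plus a a"

lemma eval_derived [simp]:
  "eval (e_not a) V M = of_bool (eval a V M = 0)"
  "eval (e_and a b) V M = of_bool (eval a V M \<noteq> 0 \<and> eval b V M \<noteq> 0)"
  "eval (e_less a b) V M = of_bool (eval a V M < eval b V M)"
  "eval (e_eq a b) V M = of_bool (eval a V M = eval b V M)"
  "eval (e_dbl a) V M = 2 * eval a V M"
  by (auto simp: e_not_def e_and_def e_less_def e_eq_def e_dbl_def)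

lemma wf_derived [simp]:
  "wf_exp (e_not a) = wf_exp a"
  "wf_exp (e_and a b) = (wf_exp a \<and> wf_exp b)"
  "wf_exp (e_less a b) = (wf_exp a \<and> wf_exp b)"
  "wf_exp (e_eq a b) = (wf_exp a \<and> wf_exp b)"
  "wf_exp (e_dbl a) = wf_exp a"
  by (auto simp: e_not_def e_and_def e_less_def e_eq_def e_dbl_def)

text \<open>A loop has \<open>K\<close> rounds, so this multiplies by \<open>2 ^ K\<close>; powers
  of two arise in this way without multiplication.\<close>

definition shift_left :: "nat \<Rightarrow> stage" where
  "shift_left r = Loop [Assign r (e_dbl (Reg r))]"

definition shift_right :: "nat \<Rightarrow> stage" where
  "shift_right r = Loop [Assign r (Halve (Reg r))]"

text \<open>Binary multiplication: the difference is the lowest bit of \<open>q\<close>, and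
  \<open>p\<close> runs through the doublings of the other factor.\<close>

definition mult_loop :: "nat \<Rightarrow> nat \<Rightarrow> nat \<Rightarrow> stage" where
  "mult_loop d p q = Loop
     [Assign d (Plus (Reg d) (IfNZ (Minus (Reg q) (e_dbl (Halve (Reg q)))) (Reg p) (Lit 0))),
      Assign p (e_dbl (Reg p)), Assign q (Halve (Reg q))]"

lemma shift_left_sem [simp]:
  "stage_sem P K (shift_left r) (V, M) = (\<lambda>i. (V i)(r := V i r * 2 ^ K), M)"
  unfolding shift_left_def by (induction K) (auto simp: fun_eq_iff)

lemma shift_right_sem [simp]:
  "stage_sem P K (shift_right r) (V, M) = (\<lambda>i. (V i)(r := V i r div 2 ^ K), M)"
  unfolding shift_right_def
  by (induction K) (auto simp: fun_eq_iff div_mult2_eq[symmetric] mult.commute)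

text \<open>Splits off bit \<open>K\<close> of \<open>q\<close>. The bit is tested by an inequality
  because parity occurs in \<open>mult_loop\<close> as a truncated difference.\<close>

lemma mod_power2_step:
  fixes q K :: nat
  shows "q mod (2 * 2 ^ K) = (if q div 2 ^ K \<le> 2 * (q div (2 * 2 ^ K)) then q mod 2 ^ K else q mod 2 ^ K + 2 ^ K)"
proof -
  have "q mod (2 ^ K * 2) = 2 ^ K * (q div 2 ^ K mod 2) + q mod 2 ^ K"
    by (rule mod_mult2_eq)
  moreover have "q div (2 * 2 ^ K) = q div 2 ^ K div 2"
    by (metis div_mult2_eq mult.commute)
  moreover have "x \<le> 2 * (x div 2) \<longleftrightarrow> even x" for x :: nat
    by presburger
  ultimately show ?thesis
    by (simp add: mult.commute mod_2_eq_odd)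
qed

text \<open>Only the \<open>K\<close> lowest bits of the multiplier enter; these are all of it once
  it is below \<open>2 ^ K\<close>.\<close>

lemma mult_loop_sem [simp]:
  assumes "distinct [d, p, q]"
  shows "stage_sem P K (mult_loop d p q) (V, M) =
    (\<lambda>i. (V i)(d := V i d + V i p * (V i q mod 2 ^ K), p := V i p * 2 ^ K, q := V i q div 2 ^ K), M)"
proof (induction K)
  case 0
  then show ?case by (auto simp: mult_loop_def fun_eq_iff)
next
  case (Suc K)
  show ?case
    using assms Suc
    by (auto simp: mult_loop_def fun_eq_iff div_mult2_eq[symmetric] mult.commute add.assoc
        mod_power2_step distrib_left)
qed

definition multiply :: "nat \<Rightarrow> exp \<Rightarrow> exp \<Rightarrow> stage list" where
  "multiply d a b = [Once [Assign d (Lit 0), Assign 15 a, Assign 16 b], mult_loop d 15 16]"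

section \<open>Parsing the header and indexing the processors\<close>

text \<open>The default \<open>length w\<close> keeps all positions within the length of the word;
  words with too few zeros then fail the length test of \<open>accepts_at\<close>.\<close>

definition next_zero :: "bool list \<Rightarrow> nat \<Rightarrow> nat" where
  "next_zero w a =
     (if \<exists>q. a \<le> q \<and> q < length w \<and> \<not> w ! q
      then LEAST q. a \<le> q \<and> q < length w \<and> \<not> w ! q else length w)"

text \<open>
  Register 5 holds the address of a scratch cell. The priority rule for concurrent writes makes
  the least position of a zero bit survive.
\<close>

definition find_zero :: "nat \<Rightarrow> exp \<Rightarrow> stage" where
  "find_zero r e = Once
     [StoreIf (Lit 1) (Reg 5) (Reg 1),
      StoreIf (e_and (e_less (Reg 0) (Reg 1))
         (e_and (e_not (Deref (Reg 0))) (e_not (Minus e (Reg 0))))) (Reg 5) (Reg 0),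
      Assign r (Deref (Reg 5))]"

lemma find_zero_sem:
  assumes "\<forall>i. V i 0 = i \<and> V i 1 = length w \<and> V i 5 = m" and "length w < m" and "length w \<le> P"
    and "0 < P" and M: "\<forall>a<length w. M a = of_bool (w ! a)" and e: "\<And>i M. eval e (V i) M = q"
  shows "\<exists>M'. stage_sem P K (find_zero r e) (V, M) = (\<lambda>i. (V i)(r := next_zero w q), M') \<and>
           (\<forall>a. a \<noteq> m \<longrightarrow> M' a = M a)"
proof -
  let ?W = "\<lambda>i. q \<le> i \<and> i < length w \<and> \<not> w ! i"
  define M1 where "M1 = M(m := length w)"
  define M2 where "M2 = M(m := next_zero w q)"
  have 1: "cmd_sem P (StoreIf (Lit 1) (Reg 5) (Reg 1)) (V, M) = (V, M1)"
    using assms by (auto simp: M1_def fun_eq_iff)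
  \<comment> \<open>The scratch cell lies beyond the input, so after the default has been stored
    there the processors still see the bits of \<open>w\<close>.\<close>
  have W: "(i < P \<and> (i < length w \<and> M1 i = 0 \<and> q - i = 0)) = ?W i" for i
    using assms by (auto simp: M1_def)
  have 2: "cmd_sem P (StoreIf (e_and (e_less (Reg 0) (Reg 1))
         (e_and (e_not (Deref (Reg 0))) (e_not (Minus e (Reg 0))))) (Reg 5) (Reg 0)) (V, M1) = (V, M2)"
  proof -
    have "(if \<exists>i<P. (i < length w \<and> M1 i = 0 \<and> q - i = 0) \<and> m = x
        then LEAST i. i < P \<and> (i < length w \<and> M1 i = 0 \<and> q - i = 0) \<and> m = x else M1 x) = M2 x" for x
    proof (cases "x = m")
      case True
      have M1m: "M1 m = length w" by (simp add: M1_def)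
      have "(\<exists>i<P. i < length w \<and> M1 i = 0 \<and> q - i = 0) = (\<exists>i. ?W i)"
        using W by metis
      moreover have "(LEAST i. i < P \<and> (i < length w \<and> M1 i = 0 \<and> q - i = 0)) = (LEAST i. ?W i)"
        unfolding W ..
      ultimately show ?thesis
        using True M1m by (auto simp: M2_def next_zero_def)
    next
      case False
      then show ?thesis by (simp add: M1_def M2_def)
    qed
    then show ?thesis using assms(1) e by (auto simp: fun_eq_iff cong: if_cong)
  qed
  have "stage_sem P K (find_zero r e) (V, M) = (\<lambda>i. (V i)(r := next_zero w q), M2)"
    using 1 2 assms(1) by (simp add: find_zero_def M2_def del: cmd_sem.simps(2))
  then show ?thesis by (auto simp: M2_def)
qed

text \<open>The processor index is written in base \<open>2 ^ K\<close>: a remainder is obtained by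
  shifting right, shifting back and subtracting.\<close>

definition split_index :: "stage list" where
  "split_index =
     [Once [Assign 5 (Lit 1), Assign 6 (Reg 0)], shift_left 5, shift_right 6,
      Once [Assign 7 (Reg 6), Assign 8 (Reg 6)], shift_right 7, shift_left 8,
      Once [Assign 8 (Minus (Reg 0) (Reg 8)), Assign 9 (Reg 7)], shift_left 9,
      Once [Assign 9 (Minus (Reg 6) (Reg 9))]]"

lemma split_index_sem:
  assumes "\<forall>i. V i 0 = i \<and> V i 1 = L"
  shows "\<exists>V'. fold (stage_sem P K) split_index (V, M) = (V', M) \<and>
           (\<forall>i. V' i 0 = i \<and> V' i 1 = L \<and> V' i 5 = 2 ^ K \<and> V' i 7 = i div 2 ^ K div 2 ^ K \<and>
             V' i 8 = i mod 2 ^ K \<and> V' i 9 = i div 2 ^ K mod 2 ^ K)"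
  using assms by (simp add: split_index_def minus_div_mult_eq_mod)

section \<open>Squaring a Boolean matrix\<close>

text \<open>The matrix begins at \<open>2 * m\<close>, clear of the input below \<open>m\<close> and
  of the scratch cell \<open>m\<close>. Register \<open>r\<close> must already hold the row number
  times \<open>m\<close>.\<close>

definition matrix_at :: "nat \<Rightarrow> nat \<Rightarrow> exp" where
  "matrix_at r s = Plus (Plus (Plus (Reg 5) (Reg 5)) (Reg r)) (Reg s)"

definition matrix_rel :: "nat \<Rightarrow> memory \<Rightarrow> (nat \<times> nat) set" where
  "matrix_rel m M = {(a, b). a < m \<and> b < m \<and> M (m + m + a * m + b) \<noteq> 0}"

text \<open>Digit 8 is the source, 9 the target and 7 the intermediate vertex. The leading digit 7
  is not reduced modulo \<open>m\<close>, so surplus processors are held back by the comparison with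
  register 5.\<close>

definition close_step :: "cmd" where
  "close_step =
     StoreIf (e_and (e_less (Reg 7) (Reg 5))
        (e_and (Deref (matrix_at 30 7)) (Deref (matrix_at 31 9)))) (matrix_at 30 9) (Lit 1)"

lemma pair_address_eq_iff:
  fixes a b c d m :: nat
  assumes "b < m" and "d < m"
  shows "a * m + b = c * m + d \<longleftrightarrow> a = c \<and> b = d"
proof
  assume "a * m + b = c * m + d"
  then have "(a * m + b) div m = (c * m + d) div m" "(a * m + b) mod m = (c * m + d) mod m"
    by simp_all
  then show "a = c \<and> b = d" using assms by simp
qed simp

lemma index_of_triple:
  fixes a b c m :: nat
  assumes "a < m" "b < m" "c < m"
  shows "\<exists>i<m ^ 3. i mod m = a \<and> i div m mod m = b \<and> i div m div m = c"
proof (intro exI conjI)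
  let ?i = "a + m * (b + m * c)"
  show "?i mod m = a" "?i div m mod m = b" "?i div m div m = c" using assms by simp_all
  have "b + m * c < m * m"
    using assms by (metis add.commute add_less_mono1 less_le_trans mult.commute mult_Suc
        mult_le_mono2 Suc_leI)
  then have "a + m * (b + m * c) < m * (m * m)"
    using assms(1) by (metis add.commute add_less_mono1 less_le_trans mult_Suc_right
        mult_le_mono2 Suc_leI)
  then show "?i < m ^ 3" by (simp add: power3_eq_cube mult.assoc)
qed

locale matrix_regs =
  fixes V :: "nat \<Rightarrow> nat \<Rightarrow> nat" and m P :: nat
  assumes regs: "V i 5 = m" "V i 7 = i div m div m" "V i 8 = i mod m" "V i 9 = i div m mod m"
      "V i 30 = V i 8 * m" "V i 31 = V i 7 * m"
    and m: "0 < m" and P: "m ^ 3 \<le> P"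
begin

lemma triple:
  assumes "a < m" "b < m" "c < m"
  obtains i where "i < P" "V i 8 = a" "V i 9 = b" "V i 7 = c"
  using index_of_triple[OF assms] P regs that by (metis order_less_le_trans)

lemma reg_less: "V i 8 < m" "V i 9 < m"
  using m by (simp_all add: regs)

text \<open>The round is exactly one squaring because all reads precede the writes and all writers
  store 1.\<close>

lemma close_step_sem:
  "\<exists>M'. cmd_sem P close_step (V, M) = (V, M') \<and>
     matrix_rel m M' = matrix_rel m M \<union> matrix_rel m M O matrix_rel m M \<and>
     (\<forall>x<m + m. M' x = M x)"
proof -
  define W where "W x i \<longleftrightarrow> i < P \<and> V i 7 < m \<and> M (m + m + V i 8 * m + V i 7) \<noteq> 0 \<and>
    M (m + m + V i 7 * m + V i 9) \<noteq> 0 \<and> m + m + V i 8 * m + V i 9 = x" for x i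
  define M' where "M' x = (if \<exists>i. W x i then 1 else M x)" for x
  have "cmd_sem P close_step (V, M) = (V, M')"
    using regs by (auto simp: close_step_def matrix_at_def M'_def W_def fun_eq_iff)
  moreover have "M' x = M x" if "x < m + m" for x
    using that by (auto simp: M'_def W_def)
  moreover have "matrix_rel m M' = matrix_rel m M \<union> matrix_rel m M O matrix_rel m M"
  proof -
    have "(\<exists>i. W (m + m + a * m + b) i) \<longleftrightarrow> (a, b) \<in> matrix_rel m M O matrix_rel m M"
      if ab: "a < m" "b < m" for a b
    proof
      assume "\<exists>i. W (m + m + a * m + b) i"
      then obtain i where i: "W (m + m + a * m + b) i" ..
      then have "V i 8 * m + V i 9 = a * m + b" by (simp add: W_def)
      then have "V i 8 = a \<and> V i 9 = b" using pair_address_eq_iff reg_less ab by blast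
      then show "(a, b) \<in> matrix_rel m M O matrix_rel m M"
        using i ab by (auto simp: W_def matrix_rel_def)
    next
      assume "(a, b) \<in> matrix_rel m M O matrix_rel m M"
      then obtain c where c: "c < m" "M (m + m + a * m + c) \<noteq> 0" "M (m + m + c * m + b) \<noteq> 0"
        by (auto simp: matrix_rel_def)
      obtain i where "i < P" "V i 8 = a" "V i 9 = b" "V i 7 = c"
        using triple ab c by blast
      then have "W (m + m + a * m + b) i" using c by (simp add: W_def)
      then show "\<exists>i. W (m + m + a * m + b) i" ..
    qed
    then show ?thesis
      by (auto simp: matrix_rel_def M'_def)
  qed
  ultimately show ?thesis by blast
qed

lemma close_loop_sem:
  "\<exists>M'. stage_sem P K (Loop [close_step]) (V, M) = (V, M') \<and>
     matrix_rel m M' = ((\<lambda>D. D \<union> D O D) ^^ K) (matrix_rel m M) \<and> (\<forall>x<m + m. M' x = M x)"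
proof (induction K)
  case 0
  then show ?case by simp
next
  case (Suc K)
  then obtain M1 where 1: "stage_sem P K (Loop [close_step]) (V, M) = (V, M1)"
     "matrix_rel m M1 = ((\<lambda>D. D \<union> D O D) ^^ K) (matrix_rel m M)" "\<forall>x<m + m. M1 x = M x"
    by blast
  obtain M2 where 2: "cmd_sem P close_step (V, M1) = (V, M2)"
     "matrix_rel m M2 = matrix_rel m M1 \<union> matrix_rel m M1 O matrix_rel m M1"
     "\<forall>x<m + m. M2 x = M1 x"
    using close_step_sem by blast
  have "stage_sem P (Suc K) (Loop [close_step]) (V, M) = (V, M2)"
    using 1(1) 2(1) by simp
  with 1 2 show ?case by (intro exI[of _ M2]) simp
qed

lemma store_diagonal:
  "\<exists>M'. cmd_sem P (StoreIf (Lit 1) (matrix_at 30 8) (Lit 1)) (V, M) = (V, M') \<and>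
     matrix_rel m M' = matrix_rel m M \<union> Id_on {..<m} \<and> (\<forall>x<m + m. M' x = M x)"
proof -
  define M' where "M' x = (if \<exists>i<P. m + m + V i 8 * m + V i 8 = x then 1 else M x)" for x
  have "cmd_sem P (StoreIf (Lit 1) (matrix_at 30 8) (Lit 1)) (V, M) = (V, M')"
    using regs by (auto simp: matrix_at_def M'_def fun_eq_iff)
  moreover have "M' x = M x" if "x < m + m" for x
    using that by (auto simp: M'_def)
  moreover have "(\<exists>i<P. m + m + V i 8 * m + V i 8 = m + m + a * m + b) \<longleftrightarrow> a = b"
    if ab: "a < m" "b < m" for a b
  proof
    assume "\<exists>i<P. m + m + V i 8 * m + V i 8 = m + m + a * m + b"
    then obtain i where "V i 8 * m + V i 8 = a * m + b" by auto
    then show "a = b" using pair_address_eq_iff[of "V i 8" m b "V i 8" a] reg_less ab by simp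
  next
    assume "a = b"
    then show "\<exists>i<P. m + m + V i 8 * m + V i 8 = m + m + a * m + b"
      using triple[OF ab(1) ab(1) ab(1)] by metis
  qed
  ultimately show ?thesis
    by (intro exI[of _ M']) (auto simp: matrix_rel_def M'_def Id_on_def)
qed

lemma store_edges:
  assumes 29: "\<And>i. V i 29 = V i 19 * m"
    and bound: "\<And>i. V i 28 \<noteq> 0 \<Longrightarrow> V i 19 < m \<and> V i r < m"
  shows "\<exists>M'. cmd_sem P (StoreIf (Reg 28) (matrix_at 29 r) (Lit 1)) (V, M) = (V, M') \<and>
     matrix_rel m M' = matrix_rel m M \<union> {(V i 19, V i r) | i. i < P \<and> V i 28 \<noteq> 0} \<and>
     (\<forall>x<m + m. M' x = M x)"
proof -
  define M' where
    "M' x = (if \<exists>i<P. V i 28 \<noteq> 0 \<and> m + m + V i 19 * m + V i r = x then 1 else M x)" for x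
  have "cmd_sem P (StoreIf (Reg 28) (matrix_at 29 r) (Lit 1)) (V, M) = (V, M')"
    using regs 29 by (auto simp: matrix_at_def M'_def fun_eq_iff)
  moreover have "M' x = M x" if "x < m + m" for x
    using that by (auto simp: M'_def)
  moreover have "(\<exists>i<P. V i 28 \<noteq> 0 \<and> m + m + V i 19 * m + V i r = m + m + a * m + b) \<longleftrightarrow>
      (\<exists>i<P. V i 28 \<noteq> 0 \<and> V i 19 = a \<and> V i r = b)" if ab: "a < m" "b < m" for a b
    using pair_address_eq_iff[of "V _ r" m b "V _ 19" a] bound ab
    by (metis (no_types, lifting) add.assoc add_left_cancel)
  ultimately show ?thesis
    using bound by (intro exI[of _ M']) (auto simp: matrix_rel_def M'_def)
qed

end

text \<open>After \<open>j\<close> rounds all paths of length at most \<open>2 ^ j\<close> are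
  present. Connected vertices have a path no longer than the number of edges, which is at most
  \<open>m * m\<close>; hence \<open>K + K\<close> rounds.\<close>

lemma squaring_closure:
  fixes S :: "(nat \<times> nat) set"
  assumes S: "S \<subseteq> {..<m} \<times> {..<m}" and m: "m \<le> 2 ^ K"
  shows "((\<lambda>D. D \<union> D O D) ^^ (K + K)) (Id_on {..<m} \<union> S) = S\<^sup>* \<inter> ({..<m} \<times> {..<m})"
proof -
  let ?T = "\<lambda>D :: (nat \<times> nat) set. D \<union> D O D" and ?D = "Id_on {..<m} \<union> S"
  define A where "A = S\<^sup>* \<inter> ({..<m} \<times> {..<m})"
  have sub: "(?T ^^ j) ?D \<subseteq> A" for j
  proof (induction j)
    case 0
    then show ?case using S by (auto simp: A_def)
  next
    case (Suc j)
    have "A O A \<subseteq> A" by (auto simp: A_def)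
    then have "(?T ^^ j) ?D O (?T ^^ j) ?D \<subseteq> A"
      using relcomp_mono[OF Suc Suc] by order
    then show ?case using Suc by simp
  qed
  have closed: "b < m" if "(a, b) \<in> S ^^ l" "a < m" for a b l
    using that
  proof (cases l)
    case (Suc k)
    then show ?thesis using that S by auto
  qed auto
  have sup: "(a, b) \<in> (?T ^^ j) ?D" if "(a, b) \<in> S ^^ l" "a < m" "l \<le> 2 ^ j" for a b l j
    using that
  proof (induction j arbitrary: a b l)
    case 0
    then have "l = 0 \<or> l = 1" by auto
    then show ?case using 0 by auto
  next
    case (Suc j)
    \<comment> \<open>The path is cut in the middle; both halves have length at most
      \<open>2 ^ j\<close> when \<open>l \<le> 2 ^ Suc j\<close>.\<close>
    define k where "k = l div 2"
    have "(a, b) \<in> S ^^ (k + (l - k))" using Suc.prems by (simp add: k_def)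
    then obtain c where c: "(a, c) \<in> S ^^ k" "(c, b) \<in> S ^^ (l - k)"
      unfolding relpow_add by blast
    have "k \<le> 2 ^ j" "l - k \<le> 2 ^ j" using Suc.prems(3) by (auto simp: k_def)
    then have "(a, c) \<in> (?T ^^ j) ?D" "(c, b) \<in> (?T ^^ j) ?D"
      using Suc.IH c Suc.prems(2) closed by blast+
    then show ?case by auto
  qed
  have fin: "finite S" using S finite_subset by blast
  have "card S \<le> m * m"
    using card_mono[OF _ S] by simp
  also have "\<dots> \<le> 2 ^ (K + K)" using m by (simp add: power_add mult_mono)
  finally have card: "card S \<le> 2 ^ (K + K)" .
  have "(a, b) \<in> (?T ^^ (K + K)) ?D" if ab: "(a, b) \<in> S\<^sup>*" "a < m" for a b
  proof -
    obtain l where "l \<le> card S" "(a, b) \<in> S ^^ l"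
      using ab(1) unfolding rtrancl_finite_eq_relpow[OF fin] by blast
    then show ?thesis using sup ab(2) card by (meson order_trans)
  qed
  then show ?thesis using sub[of "K + K"] unfolding A_def by blast
qed

section \<open>The decision procedure\<close>

text \<open>The position of the cell's bit in the configuration part of the word, serving also as
  its vertex number.\<close>

definition cell_id :: "bool \<Rightarrow> nat \<Rightarrow> nat \<Rightarrow> nat \<Rightarrow> nat \<Rightarrow> nat" where
  "cell_id tri n a b e = (if tri then 2 * (a * n + b) + e else a * n + b)"

text \<open>The last neighbour of a triangle is listed twice, so that both grids have lists of length four.\<close>

definition nbr_ids :: "bool \<Rightarrow> nat \<Rightarrow> nat \<Rightarrow> nat \<Rightarrow> nat \<Rightarrow> nat list" where
  "nbr_ids tri n a b e =
     (let up = (a + 1) mod n; dn = (a + n - 1) mod n; ri = (b + 1) mod n; le = (b + n - 1) mod n in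
      if \<not> tri then [cell_id False n up b 0, cell_id False n dn b 0, cell_id False n a ri 0, cell_id False n a le 0]
      else if e = 0 then [cell_id True n a b 1, cell_id True n dn b 1, cell_id True n a le 1, cell_id True n a le 1]
      else [cell_id True n a b 0, cell_id True n up b 0, cell_id True n a ri 0, cell_id True n a ri 0])"

definition cell_range :: "bool \<Rightarrow> nat \<Rightarrow> nat \<Rightarrow> nat \<Rightarrow> nat \<Rightarrow> bool" where
  "cell_range tri n a b e \<longleftrightarrow> a < n \<and> b < n \<and> e < 1 + of_bool tri"

text \<open>The argument \<open>row\<close> stands for the row number already multiplied by
  \<open>n\<close>.\<close>

definition id_exp :: "bool \<Rightarrow> exp \<Rightarrow> exp \<Rightarrow> exp \<Rightarrow> exp" where
  "id_exp tri row col e = (if tri then Plus (e_dbl (Plus row col)) e else Plus row col)"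

text \<open>
  Registers: 5 the power \<open>m\<close> of two, 7, 8, 9 the base \<open>m\<close> digits \<open>e, a, b\<close> of the processor
  index, 10, 11, 12 the positions of the first three zero bits, so that 10 is \<open>n\<close>; 14, 17 and 18
  the products \<open>n * n\<close>, \<open>n * a\<close> and \<open>n\<close> times the row of the queried cell.
\<close>

definition geometry :: "bool \<Rightarrow> stage" where
  "geometry tri = Once
     [Assign 34 (IfNZ (e_eq (Plus (Reg 8) (Lit 1)) (Reg 10)) (Lit 0) (Plus (Reg 17) (Reg 10))),
      Assign 35 (IfNZ (Reg 8) (Minus (Reg 17) (Reg 10)) (Minus (Reg 14) (Reg 10))),
      Assign 36 (IfNZ (e_eq (Plus (Reg 9) (Lit 1)) (Reg 10)) (Lit 0) (Plus (Reg 9) (Lit 1))),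
      Assign 37 (IfNZ (Reg 9) (Minus (Reg 9) (Lit 1)) (Minus (Reg 10) (Lit 1))),
      Assign 19 (id_exp tri (Reg 17) (Reg 9) (Reg 7)),
      Assign 20 (e_and (e_less (Reg 8) (Reg 10)) (e_and (e_less (Reg 9) (Reg 10))
        (e_less (Reg 7) (Lit (1 + of_bool tri))))),
      Assign 21 (Plus (Reg 12) (Lit (1 + of_bool tri))),
      Assign 39 (id_exp tri (Reg 18) (Minus (Minus (Reg 12) (Reg 11)) (Lit 1))
        (Deref (Plus (Reg 12) (Lit 1))))]"

lemma mod_succ: "a < n \<Longrightarrow> (a + 1) mod n = (if a + 1 = n then 0 else a + 1)" for a n :: nat
  by auto

lemma mod_pred: "a < n \<Longrightarrow> (a + n - 1) mod n = (if a = 0 then n - 1 else a - 1)" for a n :: nat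
proof (cases "a = 0")
  case False
  assume "a < n"
  with False have "(a - 1) mod n = a - 1" by simp
  moreover have "a + n - 1 = (a - 1) + n" using False by simp
  ultimately show ?thesis using False by (metis mod_add_self2)
qed simp

text \<open>Since rows are carried multiplied by \<open>n\<close>, a step on the torus adds or
  subtracts \<open>n\<close>, or wraps to \<open>0\<close> or \<open>n * n - n\<close>. Neighbouring
  coordinates are claimed only for coordinates below \<open>n\<close>; other processors hold
  arbitrary values.\<close>

lemma geometry_sem:
  assumes "\<forall>i. V i 10 = n \<and> V i 14 = n * n \<and> V i 17 = n * V i 8 \<and> V i 18 = n * (p2 - n - 1) \<and>
      V i 11 = p2 \<and> V i 12 = p3"
  shows "\<exists>V'. stage_sem P K (geometry tri) (V, M) = (V', M) \<and>
    (\<forall>i r. r \<notin> {34, 35, 36, 37, 19, 20, 21, 39} \<longrightarrow> V' i r = V i r) \<and>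
    (\<forall>i. V i 8 < n \<longrightarrow> V' i 34 = ((V i 8 + 1) mod n) * n \<and> V' i 35 = ((V i 8 + n - 1) mod n) * n) \<and>
    (\<forall>i. V i 9 < n \<longrightarrow> V' i 36 = (V i 9 + 1) mod n \<and> V' i 37 = (V i 9 + n - 1) mod n) \<and>
    (\<forall>i. V' i 19 = cell_id tri n (V i 8) (V i 9) (V i 7) \<and>
      V' i 20 = of_bool (cell_range tri n (V i 8) (V i 9) (V i 7)) \<and>
      V' i 21 = p3 + (1 + of_bool tri) \<and>
      V' i 39 = cell_id tri n (p2 - n - 1) (p3 - p2 - 1) (M (p3 + 1)))"
proof -
  have row: "n * a + n = (a + 1) * n" "n * a - n = (a - 1) * n" "n * n - n = (n - 1) * n" for a :: nat
    by (simp_all add: algebra_simps diff_mult_distrib)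
  show ?thesis
    using assms
    by (intro exI[of _ "fst (stage_sem P K (geometry tri) (V, M))"])
      (simp add: geometry_def id_exp_def cell_id_def cell_range_def mod_succ mod_pred row mult.commute
        del: add_2_eq_Suc' One_nat_def)
qed

definition neighbours :: "bool \<Rightarrow> stage" where
  "neighbours tri = Once (if tri then
     [Assign 22 (id_exp True (Reg 17) (Reg 9) (e_not (Reg 7))),
      Assign 23 (IfNZ (Reg 7) (id_exp True (Reg 34) (Reg 9) (Lit 0)) (id_exp True (Reg 35) (Reg 9) (Lit 1))),
      Assign 24 (IfNZ (Reg 7) (id_exp True (Reg 17) (Reg 36) (Lit 0)) (id_exp True (Reg 17) (Reg 37) (Lit 1))),
      Assign 25 (Reg 24)]
   else
     [Assign 22 (id_exp False (Reg 34) (Reg 9) (Lit 0)),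
      Assign 23 (id_exp False (Reg 35) (Reg 9) (Lit 0)),
      Assign 24 (id_exp False (Reg 17) (Reg 36) (Lit 0)),
      Assign 25 (id_exp False (Reg 17) (Reg 37) (Lit 0))])"

lemma neighbours_sem:
  assumes "\<forall>i. V i 17 = n * V i 8"
    and "\<forall>i. V i 8 < n \<longrightarrow> V i 34 = ((V i 8 + 1) mod n) * n \<and> V i 35 = ((V i 8 + n - 1) mod n) * n"
    and "\<forall>i. V i 9 < n \<longrightarrow> V i 36 = (V i 9 + 1) mod n \<and> V i 37 = (V i 9 + n - 1) mod n"
  shows "\<exists>V'. stage_sem P K (neighbours tri) (V, M) = (V', M) \<and>
    (\<forall>i r. r \<notin> {22, 23, 24, 25} \<longrightarrow> V' i r = V i r) \<and>
    (\<forall>i. cell_range tri n (V i 8) (V i 9) (V i 7) \<longrightarrow>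
      [V' i 22, V' i 23, V' i 24, V' i 25] = nbr_ids tri n (V i 8) (V i 9) (V i 7))"
  using assms
  by (intro exI[of _ "fst (stage_sem P K (neighbours tri) (V, M))"])
    (auto simp: neighbours_def id_exp_def cell_id_def cell_range_def nbr_ids_def Let_def mult.commute)

text \<open>Neighbours can coincide on tori of side 1 or 2, and the triangular lists repeat an
  entry. As the rule sums over a set, repeated numbers are skipped.\<close>

definition counting :: "stage" where
  "counting = Once
     [Assign 26 (Plus (Plus (Plus (Deref (Plus (Reg 21) (Reg 22)))
        (IfNZ (e_eq (Reg 23) (Reg 22)) (Lit 0) (Deref (Plus (Reg 21) (Reg 23)))))
        (IfNZ (Plus (e_eq (Reg 24) (Reg 22)) (e_eq (Reg 24) (Reg 23))) (Lit 0)
          (Deref (Plus (Reg 21) (Reg 24)))))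
        (IfNZ (Plus (Plus (e_eq (Reg 25) (Reg 22)) (e_eq (Reg 25) (Reg 23))) (e_eq (Reg 25) (Reg 24)))
          (Lit 0) (Deref (Plus (Reg 21) (Reg 25)))))]"

lemma sum_set_4:
  fixes f :: "'a \<Rightarrow> nat"
  shows "sum f (set [a, b, c, d]) = f a + (if b = a then 0 else f b) + (if c = a \<or> c = b then 0 else f c)
    + (if d = a \<or> d = b \<or> d = c then 0 else f d)"
  by (auto simp: insert_absorb insert_commute)

lemma counting_sem:
  "\<exists>V'. stage_sem P K counting (V, M) = (V', M) \<and>
    (\<forall>i r. r \<noteq> 26 \<longrightarrow> V' i r = V i r) \<and>
    (\<forall>i. V' i 26 = (\<Sum>d\<in>set [V i 22, V i 23, V i 24, V i 25]. M (V i 21 + d)))"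
  unfolding sum_set_4
  by (intro exI[of _ "fst (stage_sem P K counting (V, M))"]) (simp add: counting_def)

text \<open>Register 27 tests that the word is well formed, 38 marks inactive cells, 28 quiet ones
  and 33 those that can fire at once. The copies in 29 to 32 are later multiplied by
  \<open>m\<close> to become row offsets.\<close>

definition flags :: "bool \<Rightarrow> nat \<Rightarrow> nat \<Rightarrow> stage" where
  "flags tri k1 k2 = Once
     [Assign 27 (e_and (e_less (Minus (Minus (Reg 11) (Reg 10)) (Lit 1)) (Reg 10))
        (e_and (e_less (Minus (Minus (Reg 12) (Reg 11)) (Lit 1)) (Reg 10))
          (e_eq (Reg 1) (Plus (Reg 21) (if tri then e_dbl (Reg 14) else Reg 14))))),
      Assign 38 (e_and (Reg 27) (e_and (Reg 20) (e_not (Deref (Plus (Reg 21) (Reg 19)))))),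
      Assign 28 (e_and (Reg 38) (e_not (Reg 26))),
      Assign 33 (e_and (Reg 38)
        (e_and (e_not (e_less (Reg 26) (Lit k1))) (e_not (e_less (Lit k2) (Reg 26))))),
      Assign 29 (Reg 19), Assign 30 (Reg 8), Assign 31 (Reg 7), Assign 32 (Reg 39)]"

lemma flags_sem:
  assumes "\<forall>i. V i 1 = L \<and> V i 10 = n \<and> V i 11 = p2 \<and> V i 12 = p3 \<and> V i 14 = n * n \<and> V i 21 = B"
    and "\<forall>i. V i 20 = of_bool (rng i)"
    and "valid \<longleftrightarrow> p2 - n - 1 < n \<and> p3 - p2 - 1 < n \<and> L = B + (1 + of_bool tri) * (n * n)"
  shows "\<exists>V'. stage_sem P K (flags tri k1 k2) (V, M) = (V', M) \<and>
    (\<forall>i r. r \<notin> {27, 38, 28, 33, 29, 30, 31, 32} \<longrightarrow> V' i r = V i r) \<and>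
    (\<forall>i. (V' i 28 \<noteq> 0 \<longleftrightarrow> valid \<and> rng i \<and> M (B + V i 19) = 0 \<and> V i 26 = 0) \<and>
         (V' i 33 \<noteq> 0 \<longleftrightarrow> valid \<and> rng i \<and> M (B + V i 19) = 0 \<and> V i 26 \<in> {k1..k2}) \<and>
         V' i 29 = V i 19 \<and> V' i 30 = V i 8 \<and> V' i 31 = V i 7 \<and> V' i 32 = V i 39)"
  using assms
  by (intro exI[of _ "fst (stage_sem P K (flags tri k1 k2) (V, M))"]) (auto simp: flags_def)

text \<open>The diagonal makes the relation reflexive; two loops of \<open>K\<close> rounds give the
  \<open>K + K\<close> squarings of \<open>squaring_closure\<close>.\<close>

definition closure_stages :: "stage list" where
  "closure_stages =
     [Once [StoreIf (Lit 1) (matrix_at 30 8) (Lit 1),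
        StoreIf (Reg 28) (matrix_at 29 22) (Lit 1), StoreIf (Reg 28) (matrix_at 29 23) (Lit 1),
        StoreIf (Reg 28) (matrix_at 29 24) (Lit 1), StoreIf (Reg 28) (matrix_at 29 25) (Lit 1)],
      Loop [close_step], Loop [close_step]]"

lemma (in matrix_regs) closure_stages_sem:
  assumes 29: "\<And>i. V i 29 = V i 19 * m"
    and bound: "\<And>i r. V i 28 \<noteq> 0 \<Longrightarrow> r \<in> {19, 22, 23, 24, 25} \<Longrightarrow> V i r < m"
    and M: "\<And>x. m < x \<Longrightarrow> M x = 0" and K: "m = 2 ^ K"
  shows "\<exists>M'. fold (stage_sem P K) closure_stages (V, M) = (V, M') \<and>
    (\<forall>a<m. \<forall>b<m. M' (m + m + a * m + b) \<noteq> 0 \<longleftrightarrow>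
      (a, b) \<in> {(V i 19, V i r) | i r. i < P \<and> V i 28 \<noteq> 0 \<and> r \<in> {22, 23, 24, 25}}\<^sup>*)"
proof -
  define E where "E r = {(V i 19, V i r) | i. i < P \<and> V i 28 \<noteq> 0}" for r
  define S where "S = {(V i 19, V i r) | i r. i < P \<and> V i 28 \<noteq> 0 \<and> r \<in> {22, 23, 24, 25}}"
  have S: "S = E 22 \<union> E 23 \<union> E 24 \<union> E 25" by (auto simp: S_def E_def)
  have M0: "matrix_rel m M = {}" using M m by (auto simp: matrix_rel_def)
  have edges: "\<exists>M'. cmd_sem P (StoreIf (Reg 28) (matrix_at 29 r) (Lit 1)) (V, N) = (V, M') \<and>
     matrix_rel m M' = matrix_rel m N \<union> E r" if "r \<in> {22, 23, 24, 25}" for r N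
    unfolding E_def using store_edges[of r N] 29 bound that by blast
  obtain M1 where 1: "cmd_sem P (StoreIf (Lit 1) (matrix_at 30 8) (Lit 1)) (V, M) = (V, M1)"
      "matrix_rel m M1 = matrix_rel m M \<union> Id_on {..<m}"
    using store_diagonal by blast
  obtain M2 where 2: "cmd_sem P (StoreIf (Reg 28) (matrix_at 29 22) (Lit 1)) (V, M1) = (V, M2)"
      "matrix_rel m M2 = matrix_rel m M1 \<union> E 22" using edges[of 22 M1] by auto
  obtain M3 where 3: "cmd_sem P (StoreIf (Reg 28) (matrix_at 29 23) (Lit 1)) (V, M2) = (V, M3)"
      "matrix_rel m M3 = matrix_rel m M2 \<union> E 23" using edges[of 23 M2] by auto
  obtain M4 where 4: "cmd_sem P (StoreIf (Reg 28) (matrix_at 29 24) (Lit 1)) (V, M3) = (V, M4)"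
      "matrix_rel m M4 = matrix_rel m M3 \<union> E 24" using edges[of 24 M3] by auto
  obtain M5 where 5: "cmd_sem P (StoreIf (Reg 28) (matrix_at 29 25) (Lit 1)) (V, M4) = (V, M5)"
      "matrix_rel m M5 = matrix_rel m M4 \<union> E 25" using edges[of 25 M4] by auto
  obtain M6 where 6: "stage_sem P K (Loop [close_step]) (V, M5) = (V, M6)"
     "matrix_rel m M6 = ((\<lambda>D. D \<union> D O D) ^^ K) (matrix_rel m M5)"
    using close_loop_sem by blast
  obtain M7 where 7: "stage_sem P K (Loop [close_step]) (V, M6) = (V, M7)"
     "matrix_rel m M7 = ((\<lambda>D. D \<union> D O D) ^^ K) (matrix_rel m M6)"
    using close_loop_sem by blast
  have run: "fold (stage_sem P K) closure_stages (V, M) = (V, M7)"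
    using 1(1) 2(1) 3(1) 4(1) 5(1) 6(1) 7(1) unfolding closure_stages_def
    by (simp del: cmd_sem.simps stage_sem.simps(2))
  have "matrix_rel m M5 = Id_on {..<m} \<union> S"
    using 1 2 3 4 5 M0 S by (simp add: Un_assoc)
  then have "matrix_rel m M7 = ((\<lambda>D. D \<union> D O D) ^^ (K + K)) (Id_on {..<m} \<union> S)"
    using 6 7 by (simp add: funpow_add)
  also have "\<dots> = S\<^sup>* \<inter> ({..<m} \<times> {..<m})"
    by (rule squaring_closure) (use bound K in \<open>auto simp: S_def\<close>)
  finally have "matrix_rel m M7 = S\<^sup>* \<inter> ({..<m} \<times> {..<m})" .
  then have "\<forall>a<m. \<forall>b<m. M7 (m + m + a * m + b) \<noteq> 0 \<longleftrightarrow> (a, b) \<in> S\<^sup>*"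
    by (auto simp: matrix_rel_def set_eq_iff)
  with run show ?thesis unfolding S_def by blast
qed

text \<open>Cell 0 may still hold an input bit and is cleared first. Then each processor whose cell
  can fire and is reachable from the queried cell writes 1.\<close>

definition verdict :: "stage" where
  "verdict = Once [StoreIf (Lit 1) (Lit 0) (Lit 0),
     StoreIf (e_and (Reg 33) (Deref (matrix_at 32 19))) (Lit 0) (Lit 1)]"

lemma verdict_sem:
  assumes "0 < P" and "\<And>i. V i 5 = m" and "0 < m"
  shows "snd (stage_sem P K verdict (V, M)) 0 = 1 \<longleftrightarrow>
    (\<exists>i<P. V i 33 \<noteq> 0 \<and> M (m + m + V i 32 + V i 19) \<noteq> 0)"
  using assms by (auto simp: verdict_def matrix_at_def)

section \<open>Acceptance as a predicate on words\<close>

definition count_word :: "bool \<Rightarrow> nat \<Rightarrow> bool list \<Rightarrow> nat \<Rightarrow> nat \<Rightarrow> nat \<Rightarrow> nat" where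
  "count_word tri n c a b e = (\<Sum>d\<in>set (nbr_ids tri n a b e). of_bool (c ! d))"

definition edges_word :: "bool \<Rightarrow> nat \<Rightarrow> bool list \<Rightarrow> (nat \<times> nat) set" where
  "edges_word tri n c = {(cell_id tri n a b e, d) | a b e d. cell_range tri n a b e \<and>
     \<not> c ! cell_id tri n a b e \<and> count_word tri n c a b e = 0 \<and> d \<in> set (nbr_ids tri n a b e)}"

definition fires_word :: "bool \<Rightarrow> nat \<Rightarrow> nat \<Rightarrow> nat \<Rightarrow> bool list \<Rightarrow> nat \<Rightarrow> bool" where
  "fires_word tri n k1 k2 c v \<longleftrightarrow> (\<exists>a b e. v = cell_id tri n a b e \<and> cell_range tri n a b e \<and>
     \<not> c ! v \<and> count_word tri n c a b e \<in> {k1..k2})"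

text \<open>The zeros at \<open>n\<close>, \<open>p2\<close> and \<open>p3\<close> end the three
  unary blocks, whence the subtractions of 1 in the coordinates. The triangular code has one more
  bit, the orientation, before the configuration.\<close>

definition accepts_at :: "bool \<Rightarrow> nat \<Rightarrow> nat \<Rightarrow> bool list \<Rightarrow> nat \<Rightarrow> nat \<Rightarrow> nat \<Rightarrow> bool" where
  "accepts_at tri k1 k2 w n p2 p3 \<longleftrightarrow>
     (let B = p3 + (1 + of_bool tri); c = drop B w;
          u = cell_id tri n (p2 - n - 1) (p3 - p2 - 1) (of_bool (w ! (p3 + 1)))
      in p2 - n - 1 < n \<and> p3 - p2 - 1 < n \<and> length w = B + (1 + of_bool tri) * (n * n) \<and>
         (\<exists>v. (u, v) \<in> (edges_word tri n c)\<^sup>* \<and> fires_word tri n k1 k2 c v))"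

definition accepts :: "bool \<Rightarrow> nat \<Rightarrow> nat \<Rightarrow> bool list \<Rightarrow> bool" where
  "accepts tri k1 k2 w \<longleftrightarrow>
     (let n = next_zero w 0; p2 = next_zero w (n + 1); p3 = next_zero w (p2 + 1)
      in accepts_at tri k1 k2 w n p2 p3)"

lemma next_zero_le: "next_zero w a \<le> length w"
proof (cases "\<exists>q. a \<le> q \<and> q < length w \<and> \<not> w ! q")
  case True
  from LeastI_ex[OF this] True show ?thesis by (simp add: next_zero_def)
next
  case False
  then have "next_zero w a = length w" unfolding next_zero_def by (rule if_not_P)
  then show ?thesis by simp
qed

lemma cell_id_less:
  assumes "cell_range tri n a b e"
  shows "cell_id tri n a b e < (1 + of_bool tri) * (n * n)"
proof -
  have "a * n + b < Suc a * n" using assms by (simp add: cell_range_def)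
  also have "\<dots> \<le> n * n" using assms by (intro mult_right_mono) (auto simp: cell_range_def)
  finally show ?thesis using assms by (auto simp: cell_id_def cell_range_def)
qed

lemma nbr_ids_less:
  assumes "cell_range tri n a b e" and "d \<in> set (nbr_ids tri n a b e)"
  shows "d < (1 + of_bool tri) * (n * n)"
proof -
  have "cell_id True n x y z < n * n + n * n" if "x < n" "y < n" "z < 2" for x y z
    using cell_id_less[of True n x y z] that by (simp add: cell_range_def)
  moreover have "cell_id False n x y 0 < n * n" if "x < n" "y < n" for x y
    using cell_id_less[of False n x y 0] that by (simp add: cell_range_def)
  ultimately show ?thesis
    using assms by (auto simp: nbr_ids_def Let_def cell_range_def split: if_splits)
qed

section \<open>The program and its correctness\<close>

definition header_stages :: "stage list" where
  "header_stages = [find_zero 10 (Lit 0), find_zero 11 (Plus (Reg 10) (Lit 1)),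
     find_zero 12 (Plus (Reg 11) (Lit 1))]"

definition product_stages :: "stage list" where
  "product_stages = multiply 14 (Reg 10) (Reg 10) @ multiply 17 (Reg 10) (Reg 8) @
     multiply 18 (Reg 10) (Minus (Minus (Reg 11) (Reg 10)) (Lit 1))"

definition decider :: "bool \<Rightarrow> nat \<Rightarrow> nat \<Rightarrow> stage list" where
  "decider tri k1 k2 = split_index @ header_stages @ product_stages @
     [geometry tri, neighbours tri, counting, flags tri k1 k2] @
     [shift_left 29, shift_left 30, shift_left 31, shift_left 32] @ closure_stages @ [verdict]"

lemma wf_decider: "\<forall>s\<in>set (decider tri k1 k2). \<forall>c\<in>set (stage_cmds s). wf_cmd c"
  by (simp add: decider_def split_index_def header_stages_def find_zero_def product_stages_def
      multiply_def geometry_def neighbours_def counting_def flags_def closure_stages_def verdict_def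
      shift_left_def shift_right_def mult_loop_def id_exp_def matrix_at_def close_step_def)

lemma header_stages_sem:
  assumes V: "\<forall>i. V i 0 = i \<and> V i 1 = length w \<and> V i 5 = m" and "length w < m" and "length w \<le> P"
    and "0 < P" and M: "\<forall>a<length w. M a = of_bool (w ! a)"
    and p: "p1 = next_zero w 0" "p2 = next_zero w (p1 + 1)" "p3 = next_zero w (p2 + 1)"
  shows "\<exists>M'. fold (stage_sem P K) header_stages (V, M) = (\<lambda>i. (V i)(10 := p1, 11 := p2, 12 := p3), M') \<and>
    (\<forall>a. a \<noteq> m \<longrightarrow> M' a = M a)"
proof -
  have "\<exists>M1. stage_sem P K (find_zero 10 (Lit 0)) (V, M) = (\<lambda>i. (V i)(10 := next_zero w 0), M1) \<and>
      (\<forall>a. a \<noteq> m \<longrightarrow> M1 a = M a)"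
    by (rule find_zero_sem) (use assms in auto)
  then obtain M1 where 1: "stage_sem P K (find_zero 10 (Lit 0)) (V, M) = (\<lambda>i. (V i)(10 := p1), M1)"
      "\<forall>a. a \<noteq> m \<longrightarrow> M1 a = M a"
    using p by blast
  let ?V1 = "\<lambda>i. (V i)(10 := p1)"
  have "\<exists>M2. stage_sem P K (find_zero 11 (Plus (Reg 10) (Lit 1))) (?V1, M1)
      = (\<lambda>i. (?V1 i)(11 := next_zero w (p1 + 1)), M2) \<and> (\<forall>a. a \<noteq> m \<longrightarrow> M2 a = M1 a)"
    by (rule find_zero_sem) (use assms 1 in auto)
  then obtain M2 where 2: "stage_sem P K (find_zero 11 (Plus (Reg 10) (Lit 1))) (?V1, M1)
      = (\<lambda>i. (?V1 i)(11 := p2), M2)" "\<forall>a. a \<noteq> m \<longrightarrow> M2 a = M1 a"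
    using p by blast
  let ?V2 = "\<lambda>i. (?V1 i)(11 := p2)"
  have "\<exists>M3. stage_sem P K (find_zero 12 (Plus (Reg 11) (Lit 1))) (?V2, M2)
      = (\<lambda>i. (?V2 i)(12 := next_zero w (p2 + 1)), M3) \<and> (\<forall>a. a \<noteq> m \<longrightarrow> M3 a = M2 a)"
    by (rule find_zero_sem) (use assms 1 2 in auto)
  then obtain M3 where 3: "stage_sem P K (find_zero 12 (Plus (Reg 11) (Lit 1))) (?V2, M2)
      = (\<lambda>i. (?V2 i)(12 := p3), M3)" "\<forall>a. a \<noteq> m \<longrightarrow> M3 a = M2 a"
    using p by blast
  show ?thesis
    using 1 2 3 by (intro exI[of _ M3]) (simp add: header_stages_def)
qed

lemma product_stages_sem:
  assumes "\<forall>i. V i 10 = n \<and> V i 11 = p2 \<and> V i 8 < 2 ^ K" and "n < 2 ^ K" and "p2 < 2 ^ K"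
  shows "\<exists>V'. fold (stage_sem P K) product_stages (V, M) = (V', M) \<and>
    (\<forall>i r. r \<notin> {14, 15, 16, 17, 18} \<longrightarrow> V' i r = V i r) \<and>
    (\<forall>i. V' i 14 = n * n \<and> V' i 17 = n * V i 8 \<and> V' i 18 = n * (p2 - n - 1))"
  using assms by (simp add: product_stages_def multiply_def)

lemma decider_sem:
  assumes K: "K = nbits (length w)" and P: "(2 ^ K) ^ 3 \<le> P"
  shows "snd (fold (stage_sem P K) (decider tri k1 k2) (simd_init w)) 0 = 1 \<longleftrightarrow> accepts tri k1 k2 w"
proof -
  let ?L = "length w"
  define m :: nat where "m = 2 ^ K"
  have m: "0 < m" "?L < m" using less_power_nbits[of ?L] by (simp_all add: m_def K)
  have "m ^ 1 \<le> m ^ 3" using m by (intro power_increasing) auto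
  then have mP: "m ^ 3 \<le> P" "m \<le> P" using P by (simp_all add: m_def)
  obtain V0 M0 where init: "simd_init w = (V0, M0)" by force
  have V0: "\<forall>i. V0 i 0 = i \<and> V0 i 1 = ?L" and M0: "M0 = (\<lambda>a. if a < ?L \<and> w ! a then 1 else 0)"
    using init by (auto simp: simd_init_def pram_init_def)
  obtain V1 where 1: "fold (stage_sem P K) split_index (V0, M0) = (V1, M0)"
    "\<And>i. V1 i 0 = i" "\<And>i. V1 i 1 = ?L" "\<And>i. V1 i 5 = m" "\<And>i. V1 i 7 = i div m div m"
    "\<And>i. V1 i 8 = i mod m" "\<And>i. V1 i 9 = i div m mod m"
    using split_index_sem[OF V0, of P K M0] unfolding m_def by blast
  define n where "n = next_zero w 0"
  define p2 where "p2 = next_zero w (n + 1)"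
  define p3 where "p3 = next_zero w (p2 + 1)"
  have le: "n \<le> ?L" "p2 \<le> ?L" "p3 \<le> ?L" by (simp_all add: n_def p2_def p3_def next_zero_le)
  have "\<exists>M. fold (stage_sem P K) header_stages (V1, M0)
      = (\<lambda>i. (V1 i)(10 := n, 11 := p2, 12 := p3), M) \<and> (\<forall>a. a \<noteq> m \<longrightarrow> M a = M0 a)"
    by (rule header_stages_sem[OF _ _ _ _ _ n_def p2_def p3_def]) (use 1 m mP in \<open>auto simp: M0\<close>)
  then obtain M where hdr: "fold (stage_sem P K) header_stages (V1, M0)
      = (\<lambda>i. (V1 i)(10 := n, 11 := p2, 12 := p3), M)" and M: "\<forall>a. a \<noteq> m \<longrightarrow> M a = M0 a"
    by blast
  define V2 where "V2 = (\<lambda>i. (V1 i)(10 := n, 11 := p2, 12 := p3))"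
  obtain V3 where 3: "fold (stage_sem P K) product_stages (V2, M) = (V3, M)"
    "\<forall>i r. r \<notin> {14, 15, 16, 17, 18} \<longrightarrow> V3 i r = V2 i r"
    "\<forall>i. V3 i 14 = n * n \<and> V3 i 17 = n * V2 i 8 \<and> V3 i 18 = n * (p2 - n - 1)"
    using product_stages_sem[of V2 n p2 K P M] 1 m le by (auto simp: V2_def m_def)
  define B where "B = p3 + (1 + of_bool tri)"
  define u where "u = cell_id tri n (p2 - n - 1) (p3 - p2 - 1) (M (p3 + 1))"
  obtain V4 where 4: "stage_sem P K (geometry tri) (V3, M) = (V4, M)"
    "\<forall>i r. r \<notin> {34, 35, 36, 37, 19, 20, 21, 39} \<longrightarrow> V4 i r = V3 i r"
    "\<forall>i. V3 i 8 < n \<longrightarrow> V4 i 34 = ((V3 i 8 + 1) mod n) * n \<and> V4 i 35 = ((V3 i 8 + n - 1) mod n) * n"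
    "\<forall>i. V3 i 9 < n \<longrightarrow> V4 i 36 = (V3 i 9 + 1) mod n \<and> V4 i 37 = (V3 i 9 + n - 1) mod n"
    "\<forall>i. V4 i 19 = cell_id tri n (V3 i 8) (V3 i 9) (V3 i 7) \<and>
      V4 i 20 = of_bool (cell_range tri n (V3 i 8) (V3 i 9) (V3 i 7)) \<and>
      V4 i 21 = B \<and> V4 i 39 = u"
    using geometry_sem[of V3 n p2 p3 P K tri M] 3 unfolding B_def u_def by (auto simp: V2_def)
  obtain V5 where 5: "stage_sem P K (neighbours tri) (V4, M) = (V5, M)"
    "\<forall>i r. r \<notin> {22, 23, 24, 25} \<longrightarrow> V5 i r = V4 i r"
    "\<forall>i. cell_range tri n (V4 i 8) (V4 i 9) (V4 i 7) \<longrightarrow>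
      [V5 i 22, V5 i 23, V5 i 24, V5 i 25] = nbr_ids tri n (V4 i 8) (V4 i 9) (V4 i 7)"
    using neighbours_sem[of V4 n P K tri M] 3 4 by (auto simp: V2_def)
  obtain V6 where 6: "stage_sem P K counting (V5, M) = (V6, M)"
    "\<forall>i r. r \<noteq> 26 \<longrightarrow> V6 i r = V5 i r"
    "\<forall>i. V6 i 26 = (\<Sum>d\<in>set [V5 i 22, V5 i 23, V5 i 24, V5 i 25]. M (V5 i 21 + d))"
    using counting_sem by blast
  define valid where
    "valid \<longleftrightarrow> p2 - n - 1 < n \<and> p3 - p2 - 1 < n \<and> ?L = B + (1 + of_bool tri) * (n * n)"
  define a where "a i = i mod m" for i
  define b where "b i = i div m mod m" for i
  define e where "e i = i div m div m" for i
  have r6: "V6 i 1 = ?L" "V6 i 5 = m" "V6 i 7 = e i" "V6 i 8 = a i" "V6 i 9 = b i" "V6 i 10 = n"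
    "V6 i 11 = p2" "V6 i 12 = p3" "V6 i 14 = n * n" "V6 i 21 = B" "V6 i 39 = u"
    "V6 i 19 = cell_id tri n (a i) (b i) (e i)"
    "V6 i 20 = of_bool (cell_range tri n (a i) (b i) (e i))" for i
    using 1 3 4 5 6 by (simp_all add: V2_def a_def b_def e_def)
  have nb: "[V6 i 22, V6 i 23, V6 i 24, V6 i 25] = nbr_ids tri n (a i) (b i) (e i)"
    "V6 i 26 = (\<Sum>d\<in>set (nbr_ids tri n (a i) (b i) (e i)). M (B + d))"
    if "cell_range tri n (a i) (b i) (e i)" for i
  proof -
    have v: "V4 i 8 = a i" "V4 i 9 = b i" "V4 i 7 = e i" "V5 i 21 = B"
      using 1 3 4 5 by (simp_all add: V2_def a_def b_def e_def)
    then have v5: "[V5 i 22, V5 i 23, V5 i 24, V5 i 25] = nbr_ids tri n (a i) (b i) (e i)"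
      using 5(3) that by metis
    then show "[V6 i 22, V6 i 23, V6 i 24, V6 i 25] = nbr_ids tri n (a i) (b i) (e i)"
      using 6(2) by simp
    show "V6 i 26 = (\<Sum>d\<in>set (nbr_ids tri n (a i) (b i) (e i)). M (B + d))"
      unfolding v5[symmetric] v(4)[symmetric] by (rule 6(3)[rule_format])
  qed
  have "\<forall>i. V6 i 1 = ?L \<and> V6 i 10 = n \<and> V6 i 11 = p2 \<and> V6 i 12 = p3 \<and> V6 i 14 = n * n \<and> V6 i 21 = B"
    "\<forall>i. V6 i 20 = of_bool (cell_range tri n (a i) (b i) (e i))"
    using r6 by simp_all
  from flags_sem[OF this valid_def, of P K k1 k2 M]
  obtain V7 where 7: "stage_sem P K (flags tri k1 k2) (V6, M) = (V7, M)"
    "\<forall>i r. r \<notin> {27, 38, 28, 33, 29, 30, 31, 32} \<longrightarrow> V7 i r = V6 i r"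
    and flag: "\<forall>i. (V7 i 28 \<noteq> 0 \<longleftrightarrow> valid \<and> cell_range tri n (a i) (b i) (e i) \<and> M (B + V6 i 19) = 0 \<and> V6 i 26 = 0) \<and>
         (V7 i 33 \<noteq> 0 \<longleftrightarrow> valid \<and> cell_range tri n (a i) (b i) (e i) \<and> M (B + V6 i 19) = 0 \<and> V6 i 26 \<in> {k1..k2}) \<and>
         V7 i 29 = V6 i 19 \<and> V7 i 30 = V6 i 8 \<and> V7 i 31 = V6 i 7 \<and> V7 i 32 = V6 i 39"
    by (elim exE conjE) (rule that)
  define V where "V = (\<lambda>i. (V7 i)(29 := V7 i 29 * m, 30 := V7 i 30 * m, 31 := V7 i 31 * m, 32 := V7 i 32 * m))"
  have shifts: "fold (stage_sem P K) [shift_left 29, shift_left 30, shift_left 31, shift_left 32] (V7, M) = (V, M)"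
    by (simp add: V_def m_def)
  have frame: "V i r = V6 i r" if "r \<notin> {27, 38, 28, 33, 29, 30, 31, 32}" for i r
    using 7(2) that by (auto simp: V_def)
  have r: "V i 5 = m" "V i 7 = e i" "V i 8 = a i" "V i 9 = b i" "V i 30 = V i 8 * m" "V i 31 = V i 7 * m"
    "V i 19 = cell_id tri n (a i) (b i) (e i)" "V i 29 = V i 19 * m" "V i 32 = u * m" for i
    using 7(2) flag r6 by (simp_all add: V_def)
  interpret regs: matrix_regs V m P
    by unfold_locales (use r m mP in \<open>simp_all add: a_def b_def e_def\<close>)
  define c where "c = drop B w"
  have Mw: "M x = of_bool (w ! x)" if "x < ?L" for x
    using that M M0 m by auto
  have bits: "M (B + d) = of_bool (c ! d)" if valid "d < (1 + of_bool tri) * (n * n)" for d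
    using that Mw[of "B + d"] by (simp add: valid_def c_def)
  have count: "V6 i 26 = count_word tri n c (a i) (b i) (e i)"
    if "valid" "cell_range tri n (a i) (b i) (e i)" for i
    unfolding nb(2)[OF that(2)] count_word_def
    by (rule sum.cong[OF refl]) (use bits that nbr_ids_less in blast)
  have v28: "V i 28 \<noteq> 0 \<longleftrightarrow> valid \<and> cell_range tri n (a i) (b i) (e i) \<and>
      \<not> c ! cell_id tri n (a i) (b i) (e i) \<and> count_word tri n c (a i) (b i) (e i) = 0"
    and v33: "V i 33 \<noteq> 0 \<longleftrightarrow> valid \<and> cell_range tri n (a i) (b i) (e i) \<and>
      \<not> c ! cell_id tri n (a i) (b i) (e i) \<and> count_word tri n c (a i) (b i) (e i) \<in> {k1..k2}" for i
    using flag[rule_format, of i] r6(12)[of i] bits[OF _ cell_id_less[of tri n "a i" "b i" "e i"]] count[of i]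
    by (auto simp: V_def)
  have nbrs: "[V i 22, V i 23, V i 24, V i 25] = nbr_ids tri n (a i) (b i) (e i)"
    if "cell_range tri n (a i) (b i) (e i)" for i
    using nb(1)[OF that] frame by simp
  have less_m: "d < m" if valid "d < (1 + of_bool tri) * (n * n)" for d
    using that m by (auto simp: valid_def)
  have bound: "V i r < m" if "V i 28 \<noteq> 0" "r \<in> {19, 22, 23, 24, 25}" for i r
  proof -
    have v: valid and rng: "cell_range tri n (a i) (b i) (e i)" using that v28 by auto
    have "V i r = cell_id tri n (a i) (b i) (e i) \<or> V i r \<in> set (nbr_ids tri n (a i) (b i) (e i))"
      using that r unfolding nbrs[OF rng, symmetric] by auto
    then show ?thesis using less_m[OF v] cell_id_less[OF rng] nbr_ids_less[OF rng] by auto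
  qed
  have Mz: "M x = 0" if "m < x" for x using that M M0 m by auto
  define S where "S = {(V i 19, V i r) | i r. i < P \<and> V i 28 \<noteq> 0 \<and> r \<in> {22, 23, 24, 25}}"
  obtain M' where cl: "fold (stage_sem P K) closure_stages (V, M) = (V, M')"
    and M': "\<forall>a<m. \<forall>b<m. M' (m + m + a * m + b) \<noteq> 0 \<longleftrightarrow> (a, b) \<in> S\<^sup>*"
    using regs.closure_stages_sem[of M K] r bound Mz m_def unfolding S_def by blast
  have "fold (stage_sem P K) (decider tri k1 k2) (simd_init w) = stage_sem P K verdict (V, M')"
    unfolding decider_def fold_append comp_apply init 1(1) hdr V2_def[symmetric] 3(1)
    using 4(1) 5(1) 6(1) 7(1) shifts cl by simp
  then have res: "snd (fold (stage_sem P K) (decider tri k1 k2) (simd_init w)) 0 = 1 \<longleftrightarrow>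
      (\<exists>i<P. V i 33 \<noteq> 0 \<and> M' (m + m + u * m + V i 19) \<noteq> 0)"
    using verdict_sem[of P V m K M'] mP m r by simp
  show ?thesis
  proof (cases valid)
    case False
    \<comment> \<open>For a malformed word no firing flag is set, so cell 0 stays cleared.\<close>
    then have "\<not> accepts tri k1 k2 w"
      unfolding accepts_def accepts_at_def Let_def n_def[symmetric] p2_def[symmetric]
        p3_def[symmetric] B_def[symmetric] valid_def by blast
    then show ?thesis using res v33 False by simp
  next
    case True
    have n0: "0 < n" "n < m" using True m le by (auto simp: valid_def)
    \<comment> \<open>The orientation digit takes the values 0 and 1, so the base must be at least 2
      for every triangle to have a processor.\<close>
    have "1 < m" using True m by (auto simp: valid_def B_def)
    have find: "\<exists>i<P. a i = x \<and> b i = y \<and> e i = z" if "cell_range tri n x y z" for x y z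
    proof -
      have "x < m" "y < m" "z < m"
        using that n0 \<open>1 < m\<close> by (cases tri; simp add: cell_range_def)+
      then obtain i where "i < P" "V i 8 = x" "V i 9 = y" "V i 7 = z" by (rule regs.triple)
      then show ?thesis using r by metis
    qed
    have S_eq: "S = edges_word tri n c"
    proof
      show "S \<subseteq> edges_word tri n c"
      proof
        fix z assume "z \<in> S"
        then obtain i s where z: "z = (V i 19, V i s)" "V i 28 \<noteq> 0" "s \<in> {22, 23, 24, 25}"
          by (auto simp: S_def)
        have rng: "cell_range tri n (a i) (b i) (e i)" using z v28 by blast
        have "V i s \<in> set (nbr_ids tri n (a i) (b i) (e i))"
          using z unfolding nbrs[OF rng, symmetric] by auto
        then show "z \<in> edges_word tri n c"
          using z(1) z(2)[unfolded v28] r(7) unfolding edges_word_def by blast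
      qed
      show "edges_word tri n c \<subseteq> S"
      proof
        fix z assume "z \<in> edges_word tri n c"
        then obtain x y k d where z: "z = (cell_id tri n x y k, d)" "cell_range tri n x y k"
          "\<not> c ! cell_id tri n x y k" "count_word tri n c x y k = 0" "d \<in> set (nbr_ids tri n x y k)"
          by (auto simp: edges_word_def)
        obtain i where i: "i < P" "a i = x" "b i = y" "e i = k" using find[OF z(2)] by blast
        have "V i 28 \<noteq> 0" using v28 True z i by simp
        moreover have "\<exists>s\<in>{22, 23, 24, 25}. V i s = d"
          using z(5) nbrs[of i] i z(2) by (metis insertE insertI1 insertI2 empty_iff list.set)
        then obtain s where s: "s \<in> {22, 23, 24, 25}" "V i s = d" by blast
        moreover have "z = (V i 19, V i s)" using z(1) i r(7)[of i] s by simp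
        ultimately show "z \<in> S" using i(1) unfolding S_def by blast
      qed
    qed
    have w_bit: "M (p3 + 1) = of_bool (w ! (p3 + 1))" if tri
      by (rule Mw) (use that True n0 in \<open>simp add: valid_def B_def\<close>)
    have u: "u = cell_id tri n (p2 - n - 1) (p3 - p2 - 1) (of_bool (w ! (p3 + 1)))"
      using w_bit by (simp add: u_def cell_id_def)
    have "cell_range tri n (p2 - n - 1) (p3 - p2 - 1) (if tri then of_bool (w ! (p3 + 1)) else 0)"
      using True by (auto simp: cell_range_def valid_def)
    from cell_id_less[OF this] have um: "u < m"
      using less_m[OF True] u by (auto simp: cell_id_def)
    have "(\<exists>i<P. V i 33 \<noteq> 0 \<and> M' (m + m + u * m + V i 19) \<noteq> 0) \<longleftrightarrow>
        (\<exists>v. (u, v) \<in> S\<^sup>* \<and> fires_word tri n k1 k2 c v)"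
    proof
      assume "\<exists>i<P. V i 33 \<noteq> 0 \<and> M' (m + m + u * m + V i 19) \<noteq> 0"
      then obtain i where i: "V i 33 \<noteq> 0" "M' (m + m + u * m + V i 19) \<noteq> 0" by blast
      have f: "fires_word tri n k1 k2 c (V i 19)"
        using i(1)[unfolded v33] r(7)[of i] unfolding fires_word_def by metis
      have "V i 19 < m"
        using less_m[OF True cell_id_less] i(1)[unfolded v33] r(7)[of i] by metis
      then have "(u, V i 19) \<in> S\<^sup>*" using M' um i(2) by blast
      then show "\<exists>v. (u, v) \<in> S\<^sup>* \<and> fires_word tri n k1 k2 c v" using f by blast
    next
      assume "\<exists>v. (u, v) \<in> S\<^sup>* \<and> fires_word tri n k1 k2 c v"
      then obtain v where uv: "(u, v) \<in> S\<^sup>*" and "fires_word tri n k1 k2 c v" by blast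
      then obtain x y k where v: "v = cell_id tri n x y k" "cell_range tri n x y k"
        "\<not> c ! v" "count_word tri n c x y k \<in> {k1..k2}"
        by (auto simp: fires_word_def)
      obtain i where i: "i < P" "a i = x" "b i = y" "e i = k" using find[OF v(2)] by blast
      have "V i 33 \<noteq> 0" "V i 19 = v" using v33 True v i r(7)[of i] by simp_all
      moreover have "v < m" using less_m[OF True cell_id_less[OF v(2)]] v(1) by simp
      then have "M' (m + m + u * m + v) \<noteq> 0" using M' um uv by blast
      ultimately show "\<exists>i<P. V i 33 \<noteq> 0 \<and> M' (m + m + u * m + V i 19) \<noteq> 0"
        using i(1) by blast
    qed
    moreover have "accepts tri k1 k2 w \<longleftrightarrow> (\<exists>v. (u, v) \<in> S\<^sup>* \<and> fires_word tri n k1 k2 c v)"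
      unfolding accepts_def accepts_at_def Let_def n_def[symmetric] p2_def[symmetric]
        p3_def[symmetric] B_def[symmetric] u[symmetric] c_def[symmetric] S_eq
      using True unfolding valid_def by blast
    ultimately show ?thesis using res by simp
  qed
qed

text \<open>The polynomial \<open>(2 * L + 1) ^ 3\<close> dominates \<open>m ^ 3\<close> by
  \<open>power_nbits_le\<close>.\<close>

theorem accepts_in_NC:
  assumes "\<And>w. w \<in> A \<longleftrightarrow> accepts tri k1 k2 w"
  shows "A \<in> NC"
proof (rule NC_I[OF wf_decider, where procs = "[:1, 2:] ^ 3"])
  fix w :: "bool list"
  have "(2 ^ nbits (length w)) ^ 3 \<le> poly ([:1, 2:] ^ 3) (length w)"
    using power_nbits_le[of "length w"] by (auto intro!: power_mono simp: mult.commute)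
  from decider_sem[OF refl this] assms
  show "snd (fold (stage_sem (poly ([:1, 2:] ^ 3) (length w)) (nbits (length w)))
      (decider tri k1 k2) (simd_init w)) 0 = 1 \<longleftrightarrow> w \<in> A"
    by blast
qed

section \<open>Decoding the instances\<close>

lemma length_unary [simp]: "length (unary k) = k + 1"
  by (simp add: unary_def)

lemma next_zero_unary: "next_zero (ys @ unary k @ zs) (length ys) = length ys + k"
proof -
  let ?w = "ys @ unary k @ zs"
  let ?Q = "\<lambda>q. length ys \<le> q \<and> q < length ?w \<and> \<not> ?w ! q"
  have Q: "?Q (length ys + k)" by (simp add: unary_def nth_append)
  moreover have "length ys + k \<le> q" if "?Q q" for q
  proof (rule ccontr)
    assume "\<not> length ys + k \<le> q"
    moreover have "length ys \<le> q" using that by blast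
    ultimately have "q - length ys < k" by linarith
    then have "?w ! q" using \<open>length ys \<le> q\<close> by (simp add: unary_def nth_append)
    then show False using that by blast
  qed
  ultimately have "(LEAST q. ?Q q) = length ys + k" by (rule Least_equality)
  moreover have "\<exists>q. ?Q q" using Q by blast
  ultimately show ?thesis unfolding next_zero_def by (simp only: if_True)
qed

text \<open>All bits from \<open>a\<close> to the first zero are ones, so a unary block can be split
  off. This serves words not yet known to be codes.\<close>

lemma next_zero_split:
  assumes "next_zero w a < length w"
  shows "a \<le> next_zero w a \<and> drop a w = unary (next_zero w a - a) @ drop (next_zero w a + 1) w"
proof -
  let ?Q = "\<lambda>q. a \<le> q \<and> q < length w \<and> \<not> w ! q"
  let ?z = "next_zero w a"
  have ex: "\<exists>q. ?Q q"
  proof (rule ccontr)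
    assume "\<not> ?thesis"
    then have "?z = length w" unfolding next_zero_def by (rule if_not_P)
    with assms show False by simp
  qed
  then have z: "?z = (LEAST q. ?Q q)" unfolding next_zero_def by (rule if_P)
  have Qz: "?Q ?z" unfolding z using ex by (rule LeastI_ex)
  have less: "w ! q" if "a \<le> q" "q < ?z" for q
  proof -
    have "\<not> ?Q q" using that(2) unfolding z by (rule not_less_Least)
    then show ?thesis using that Qz by auto
  qed
  have "drop a w = unary (?z - a) @ drop (?z + 1) w"
  proof (rule nth_equalityI)
    show "length (drop a w) = length (unary (?z - a) @ drop (?z + 1) w)" using Qz by auto
    fix i assume i: "i < length (drop a w)"
    consider "i < ?z - a" | "i = ?z - a" | "i > ?z - a" by linarith
    then show "drop a w ! i = (unary (?z - a) @ drop (?z + 1) w) ! i"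
    proof cases
      case 1
      then show ?thesis using less[of "a + i"] i by (simp add: unary_def nth_append)
    next
      case 2
      then show ?thesis using Qz by (simp add: unary_def nth_append)
    next
      case 3
      then show ?thesis using Qz i by (simp add: unary_def nth_append add.commute)
    qed
  qed
  with Qz show ?thesis by simp
qed

definition fires_eventually :: "bool \<Rightarrow> nat \<Rightarrow> nat \<Rightarrow> nat \<Rightarrow> bool list \<Rightarrow> nat \<Rightarrow> bool" where
  "fires_eventually tri n k1 k2 c u \<longleftrightarrow>
     (\<exists>v. (u, v) \<in> (edges_word tri n c)\<^sup>* \<and> fires_word tri n k1 k2 c v)"

lemma accepts_unary_iff:
  assumes w: "w = unary n @ unary i @ unary j @ r"
  shows "accepts tri k1 k2 w \<longleftrightarrow>
     i < n \<and> j < n \<and> length r = of_bool tri + (1 + of_bool tri) * (n * n) \<and>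
     fires_eventually tri n k1 k2 (drop (of_bool tri) r) (cell_id tri n i j (of_bool (r ! 0)))"
proof -
  have 1: "next_zero w 0 = n"
    using next_zero_unary[of "[]" n "unary i @ unary j @ r"] w by simp
  have 2: "next_zero w (n + 1) = n + 1 + i"
    using next_zero_unary[of "unary n" i "unary j @ r"] w by simp
  have 3: "next_zero w (n + 1 + i + 1) = n + 1 + i + 1 + j"
    using next_zero_unary[of "unary n @ unary i" j r] w by simp
  define p3 where "p3 = n + 1 + i + 1 + j"
  have d: "drop (p3 + (1 + of_bool tri)) w = drop (of_bool tri) r"
    unfolding w p3_def by (simp add: of_bool_def)
  have u: "cell_id tri n i j (of_bool (w ! (p3 + 1))) = cell_id tri n i j (of_bool (r ! 0))"
    unfolding w p3_def by (simp add: nth_append)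
  have l: "length w = p3 + (1 + of_bool tri) + (1 + of_bool tri) * (n * n) \<longleftrightarrow>
    length r = of_bool tri + (1 + of_bool tri) * (n * n)"
    unfolding w p3_def by simp
  have ij: "n + 1 + i - n - 1 = i" "p3 - (n + 1 + i) - 1 = j" by (simp_all add: p3_def)
  show ?thesis
    unfolding accepts_def Let_def 1 2 3 accepts_at_def p3_def[symmetric] d u l ij
      fires_eventually_def ..
qed

text \<open>The length equation puts \<open>p3\<close> inside the word, so it is a genuine zero
  rather than the default; \<open>p2\<close> and then \<open>n\<close> lie before it and are genuine
  zeros as well.\<close>

lemma accepts_imp_unary:
  assumes "accepts tri k1 k2 w"
  shows "\<exists>n i j r. w = unary n @ unary i @ unary j @ r"
proof -
  define n where "n = next_zero w 0"
  define p2 where "p2 = next_zero w (n + 1)"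
  define p3 where "p3 = next_zero w (p2 + 1)"
  have "length w = p3 + (1 + of_bool tri) + (1 + of_bool tri) * (n * n)"
    using assms unfolding accepts_def accepts_at_def Let_def n_def p2_def p3_def by blast
  then have "p3 < length w" by simp
  then have 3: "p2 + 1 \<le> p3" "drop (p2 + 1) w = unary (p3 - (p2 + 1)) @ drop (p3 + 1) w"
    using next_zero_split[of w "p2 + 1"] by (simp_all add: p3_def)
  then have "p2 < length w" using \<open>p3 < length w\<close> by simp
  then have 2: "n + 1 \<le> p2" "drop (n + 1) w = unary (p2 - (n + 1)) @ drop (p2 + 1) w"
    using next_zero_split[of w "n + 1"] by (simp_all add: p2_def)
  then have "n < length w" using \<open>p2 < length w\<close> by simp
  then have 1: "w = unary n @ drop (n + 1) w"
    using next_zero_split[of w 0] by (simp add: n_def)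
  show ?thesis
    using 1 unfolding 2(2) 3(2) by blast
qed

section \<open>Configurations as lists of bits\<close>

lemma length_concat_uniform:
  "(\<And>a. a < k \<Longrightarrow> length (f a) = l) \<Longrightarrow> length (concat (map f [0..<k])) = k * l"
  by (induction k) auto

lemma nth_concat_uniform:
  assumes "\<And>a. a < k \<Longrightarrow> length (f a) = l" and "a < k" and "b < l"
  shows "concat (map f [0..<k]) ! (a * l + b) = f a ! b"
  using assms
proof (induction k)
  case (Suc k)
  have "length (concat (map f [0..<k])) = k * l"
    using Suc.prems(1) by (intro length_concat_uniform) simp
  show ?case
  proof (cases "a < k")
    case True
    have "a * l + b < Suc a * l" using Suc.prems by simp
    also have "\<dots> \<le> k * l" using True by (intro mult_right_mono) auto
    finally show ?thesis using Suc True \<open>length _ = k * l\<close> by (simp add: nth_append)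
  next
    case False
    then have "a = k" using Suc.prems by simp
    then show ?thesis using Suc.prems \<open>length _ = k * l\<close> by (simp add: nth_append)
  qed
qed simp

text \<open>Used for surjectivity of the coding: any word of the right length lists some
  configuration row by row.\<close>

lemma concat_chunks:
  assumes "length r = k * l"
  shows "concat (map (\<lambda>a. map (\<lambda>b. r ! (a * l + b)) [0..<l]) [0..<k]) = r"
proof (rule nth_equalityI)
  let ?f = "\<lambda>a. map (\<lambda>b. r ! (a * l + b)) [0..<l]"
  show len: "length (concat (map ?f [0..<k])) = length r"
    using length_concat_uniform[of k ?f l] assms by simp
  fix i assume "i < length (concat (map ?f [0..<k]))"
  then have i: "i < k * l" using len assms by simp
  then have l: "0 < l" by (cases l) auto
  have "i div l < k" using i by (simp add: less_mult_imp_div_less)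
  then have "concat (map ?f [0..<k]) ! (i div l * l + i mod l) = ?f (i div l) ! (i mod l)"
    using l by (intro nth_concat_uniform) auto
  then show "concat (map ?f [0..<k]) ! i = r ! i" using l by simp
qed

lemma cell_id_inj:
  assumes "cell_range tri n a b e" and "cell_range tri n a' b' e'"
    and "cell_id tri n a b e = cell_id tri n a' b' e'"
  shows "a = a' \<and> b = b' \<and> e = e'"
proof (cases tri)
  case True
  then have lt: "e < 2" "e' < 2" and eq: "(a * n + b) * 2 + e = (a' * n + b') * 2 + e'"
    using assms by (simp_all add: cell_range_def cell_id_def)
  then have "a * n + b = a' * n + b' \<and> e = e'" using pair_address_eq_iff[of e 2 e'] by blast
  then show ?thesis using pair_address_eq_iff[of b n b' a a'] assms by (simp add: cell_range_def)
next
  case False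
  then show ?thesis
    using pair_address_eq_iff[of b n b' a a'] assms by (simp add: cell_range_def cell_id_def)
qed

section \<open>Transfer between words and grids\<close>

text \<open>Both grids are treated at once: \<open>\<kappa>\<close> gives the coordinates of a cell,
  and its composition \<open>\<psi>\<close> with \<open>cell_id\<close> is injective on
  \<open>G\<close> and carries quiet edges and firing cells to their counterparts on words.\<close>

lemma fires_eventually_iff_unstable:
  fixes G :: "'c set" and \<kappa> :: "'c \<Rightarrow> nat \<times> nat \<times> nat"
  assumes fin: "finite G" and N: "\<And>c. c \<in> G \<Longrightarrow> N c \<subseteq> G" and k: "k1 \<le> 1" "1 \<le> k2"
    and inj: "inj_on \<kappa> G"
    and cells: "\<And>a b e. cell_range tri n a b e \<longleftrightarrow> (a, b, e) \<in> \<kappa> ` G"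
    and nbrs: "\<And>c a b e. c \<in> G \<Longrightarrow> \<kappa> c = (a, b, e) \<Longrightarrow>
      set (nbr_ids tri n a b e) = (\<lambda>d. case \<kappa> d of (a, b, e) \<Rightarrow> cell_id tri n a b e) ` N c"
    and x: "\<And>c a b e. c \<in> G \<Longrightarrow> \<kappa> c = (a, b, e) \<Longrightarrow> x c = r ! cell_id tri n a b e"
    and u: "u \<in> G" "\<kappa> u = (i, j, f)"
  shows "fires_eventually tri n k1 k2 r (cell_id tri n i j f) \<longleftrightarrow>
    async_unstable G (lifelike_freezing N k1 k2) x u"
proof -
  define \<psi> where "\<psi> c = (case \<kappa> c of (a, b, e) \<Rightarrow> cell_id tri n a b e)" for c
  have inj_\<psi>: "inj_on \<psi> G"
  proof (rule inj_onI)
    fix c d assume cd: "c \<in> G" "d \<in> G" "\<psi> c = \<psi> d"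
    obtain a b e a' b' e' where *: "\<kappa> c = (a, b, e)" "\<kappa> d = (a', b', e')"
      by (metis prod_cases3)
    have "cell_range tri n a b e" "cell_range tri n a' b' e'"
      unfolding cells using cd * by (metis imageI)+
    then have "\<kappa> c = \<kappa> d" using cell_id_inj[of tri n a b e a' b' e'] cd(3) * by (simp add: \<psi>_def)
    then show "c = d" using inj cd by (simp add: inj_onD)
  qed
  have x\<psi>: "x c = r ! \<psi> c" if "c \<in> G" for c
    using x[OF that] by (cases "\<kappa> c") (auto simp: \<psi>_def)
  have nb: "set (nbr_ids tri n a b e) = \<psi> ` N c" if "c \<in> G" "\<kappa> c = (a, b, e)" for c a b e
    using nbrs[OF that] unfolding \<psi>_def .
  have count: "count_word tri n r a b e = active_count N x c" if "c \<in> G" "\<kappa> c = (a, b, e)" for c a b e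
  proof -
    \<comment> \<open>Injectivity reindexes the sum over neighbour numbers to the set
      \<open>N c\<close>, so coinciding neighbours are counted once on both sides.\<close>
    have "inj_on \<psi> (N c)" using inj_\<psi> N[OF that(1)] by (rule inj_on_subset)
    then have "count_word tri n r a b e = (\<Sum>d\<in>N c. of_bool (r ! \<psi> d))"
      unfolding count_word_def nb[OF that] by (simp add: sum.reindex)
    also have "\<dots> = active_count N x c"
      unfolding active_count_def using N[OF that(1)] x\<psi> by (intro sum.cong) auto
    finally show ?thesis .
  qed
  have edges: "edges_word tri n r = {(\<psi> c, \<psi> d) | c d. (c, d) \<in> quiet_edges G N x}"
  proof (intro set_eqI iffI)
    fix z assume "z \<in> edges_word tri n r"
    then obtain a b e d where z: "z = (cell_id tri n a b e, d)" "cell_range tri n a b e"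
      "\<not> r ! cell_id tri n a b e" "count_word tri n r a b e = 0" "d \<in> set (nbr_ids tri n a b e)"
      by (auto simp: edges_word_def)
    obtain c where c: "c \<in> G" "\<kappa> c = (a, b, e)" using z(2) unfolding cells by (metis imageE)
    obtain d' where d': "d' \<in> N c" "d = \<psi> d'" using z(5) nb[OF c] by auto
    have "(c, d') \<in> quiet_edges G N x"
      using z c d' count[OF c] x[OF c] by (simp add: quiet_edges_def)
    moreover have "z = (\<psi> c, \<psi> d')" using z(1) c d' by (simp add: \<psi>_def)
    ultimately show "z \<in> {(\<psi> c, \<psi> d) | c d. (c, d) \<in> quiet_edges G N x}" by blast
  next
    fix z assume "z \<in> {(\<psi> c, \<psi> d) | c d. (c, d) \<in> quiet_edges G N x}"
    then obtain c d where z: "z = (\<psi> c, \<psi> d)" "c \<in> G" "\<not> x c" "active_count N x c = 0" "d \<in> N c"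
      by (auto simp: quiet_edges_def)
    obtain a b e where c: "\<kappa> c = (a, b, e)" by (metis prod_cases3)
    have "cell_range tri n a b e" unfolding cells using z(2) c by (metis imageI)
    moreover have "\<psi> c = cell_id tri n a b e" using c by (simp add: \<psi>_def)
    moreover have "\<psi> d \<in> set (nbr_ids tri n a b e)" using nb[OF z(2) c] z(5) by blast
    ultimately show "z \<in> edges_word tri n r"
      using z c count[OF z(2) c] x[OF z(2) c] unfolding edges_word_def by auto
  qed
  have fires: "fires_word tri n k1 k2 r v \<longleftrightarrow> (\<exists>c\<in>G. v = \<psi> c \<and> can_fire N k1 k2 x c)" for v
  proof
    assume "fires_word tri n k1 k2 r v"
    then obtain a b e where v: "v = cell_id tri n a b e" "cell_range tri n a b e"
      "\<not> r ! v" "count_word tri n r a b e \<in> {k1..k2}" by (auto simp: fires_word_def)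
    obtain c where c: "c \<in> G" "\<kappa> c = (a, b, e)" using v(2) unfolding cells by (metis imageE)
    then show "\<exists>c\<in>G. v = \<psi> c \<and> can_fire N k1 k2 x c"
      using v count[OF c] x[OF c] by (auto simp: can_fire_def \<psi>_def intro!: bexI[of _ c])
  next
    assume "\<exists>c\<in>G. v = \<psi> c \<and> can_fire N k1 k2 x c"
    then obtain c where c: "c \<in> G" "v = \<psi> c" "can_fire N k1 k2 x c" by blast
    obtain a b e where abe: "\<kappa> c = (a, b, e)" by (metis prod_cases3)
    have "cell_range tri n a b e" unfolding cells using c(1) abe by (metis imageI)
    moreover have v: "v = cell_id tri n a b e" using c(2) abe by (simp add: \<psi>_def)
    moreover have "\<not> r ! v" "count_word tri n r a b e \<in> {k1..k2}"
      using c(3) v count[OF c(1) abe] x[OF c(1) abe] by (simp_all add: can_fire_def)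
    ultimately show "fires_word tri n k1 k2 r v"
      unfolding fires_word_def by blast
  qed
  have step_G: "v \<in> G" if "(u, v) \<in> (quiet_edges G N x)\<^sup>*" for v
    using that by (induction rule: rtrancl_induct) (use u N in \<open>auto simp: quiet_edges_def\<close>)
  have forth: "(\<psi> u, \<psi> v) \<in> (edges_word tri n r)\<^sup>*" if "(u, v) \<in> (quiet_edges G N x)\<^sup>*" for v
    using that
  proof (induction rule: rtrancl_induct)
    case (step v v')
    have "(\<psi> v, \<psi> v') \<in> edges_word tri n r" unfolding edges using step.hyps by blast
    with step.IH show ?case by (rule rtrancl_into_rtrancl)
  qed simp
  \<comment> \<open>The vertex reached and the source of the next edge have the same image, and
    injectivity identifies them, so edges lifted one by one fit together.\<close>
  have lift_path: "\<exists>v. z = \<psi> v \<and> (u, v) \<in> (quiet_edges G N x)\<^sup>*" if "(\<psi> u, z) \<in> (edges_word tri n r)\<^sup>*" for z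
    using that
  proof (induction rule: rtrancl_induct)
    case base
    then show ?case by blast
  next
    case (step y z)
    then obtain v c d where v: "y = \<psi> v" "(u, v) \<in> (quiet_edges G N x)\<^sup>*"
      and cd: "y = \<psi> c" "z = \<psi> d" "(c, d) \<in> quiet_edges G N x"
      unfolding edges by blast
    have "c \<in> G" using cd(3) by (simp add: quiet_edges_def)
    then have "v = c" using inj_\<psi> v cd step_G by (metis inj_onD)
    then have "(u, d) \<in> (quiet_edges G N x)\<^sup>*" using v(2) cd(3) by (metis rtrancl.rtrancl_into_rtrancl)
    then show ?case using cd(2) by blast
  qed
  have "cell_id tri n i j f = \<psi> u" using u by (simp add: \<psi>_def)
  moreover have "(\<exists>v. (\<psi> u, v) \<in> (edges_word tri n r)\<^sup>* \<and> fires_word tri n k1 k2 r v) \<longleftrightarrow>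
      (\<exists>v. (u, v) \<in> (quiet_edges G N x)\<^sup>* \<and> can_fire N k1 k2 x v)"
  proof
    assume "\<exists>v. (\<psi> u, v) \<in> (edges_word tri n r)\<^sup>* \<and> fires_word tri n k1 k2 r v"
    then obtain z where z: "(\<psi> u, z) \<in> (edges_word tri n r)\<^sup>*" "fires_word tri n k1 k2 r z" by blast
    obtain c where c: "c \<in> G" "z = \<psi> c" "can_fire N k1 k2 x c" using z(2) fires by blast
    obtain v where v: "z = \<psi> v" "(u, v) \<in> (quiet_edges G N x)\<^sup>*" using lift_path[OF z(1)] by blast
    have "v = c" using inj_\<psi> c v step_G by (metis inj_onD)
    then show "\<exists>v. (u, v) \<in> (quiet_edges G N x)\<^sup>* \<and> can_fire N k1 k2 x v" using c v by blast
  next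
    assume "\<exists>v. (u, v) \<in> (quiet_edges G N x)\<^sup>* \<and> can_fire N k1 k2 x v"
    then show "\<exists>v. (\<psi> u, v) \<in> (edges_word tri n r)\<^sup>* \<and> fires_word tri n k1 k2 r v"
      using forth fires step_G by blast
  qed
  moreover have "async_unstable G (lifelike_freezing N k1 k2) x u \<longleftrightarrow>
      (\<exists>v. (u, v) \<in> (quiet_edges G N x)\<^sup>* \<and> can_fire N k1 k2 x v)"
    by (rule async_unstable_iff_quiet_path) (use fin N k u in auto)
  ultimately show ?thesis unfolding fires_eventually_def by simp
qed

text \<open>The third coordinate \<open>f\<close> is normalised to the \<open>0\<close> given by
  \<open>\<kappa>\<close>, because \<open>accepts_unary_iff\<close> passes a bit of the word
  there.\<close>

lemma square_fires_iff_unstable: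
  assumes k: "k1 \<le> 1" "1 \<le> k2" and u: "(i, j) \<in> square_grid n"
    and x: "\<And>a b. a < n \<Longrightarrow> b < n \<Longrightarrow> x (a, b) = r ! (a * n + b)"
  shows "fires_eventually False n k1 k2 r (cell_id False n i j f) \<longleftrightarrow>
    async_unstable (square_grid n) (lifelike_freezing (square_nbhd n) k1 k2) x (i, j)"
proof -
  have "cell_id False n i j f = cell_id False n i j 0" by (simp add: cell_id_def)
  moreover have "fires_eventually False n k1 k2 r (cell_id False n i j 0) \<longleftrightarrow>
    async_unstable (square_grid n) (lifelike_freezing (square_nbhd n) k1 k2) x (i, j)"
  proof (rule fires_eventually_iff_unstable[where \<kappa> = "\<lambda>(a, b). (a, b, 0)"])
    show "square_nbhd n c \<subseteq> square_grid n" if "c \<in> square_grid n" for c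
      using that by (cases c) (auto simp: square_grid_def)
    show "set (nbr_ids False n a b e) =
        (\<lambda>d. case case d of (a, b) \<Rightarrow> (a, b, 0) of (a, b, e) \<Rightarrow> cell_id False n a b e) ` square_nbhd n c"
      if "c \<in> square_grid n" "(case c of (a, b) \<Rightarrow> (a, b, 0)) = (a, b, e)" for c a b e
      using that by (cases c) (auto simp: nbr_ids_def Let_def)
    show "x c = r ! cell_id False n a b e"
      if "c \<in> square_grid n" "(case c of (a, b) \<Rightarrow> (a, b, 0)) = (a, b, e)" for c a b e
      using that x by (cases c) (auto simp: square_grid_def cell_id_def)
  qed (use k u in \<open>auto simp: square_grid_def inj_on_def cell_range_def image_iff\<close>)
  ultimately show ?thesis by simp
qed

lemma triangular_fires_iff_unstable:
  assumes k: "k1 \<le> 1" "1 \<le> k2" and u: "(i, j, d) \<in> triangular_grid n"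
    and x: "\<And>a b e. a < n \<Longrightarrow> b < n \<Longrightarrow> x (a, b, e) = r ! (2 * (a * n + b) + of_bool e)"
  shows "fires_eventually True n k1 k2 r (cell_id True n i j (of_bool d)) \<longleftrightarrow>
    async_unstable (triangular_grid n) (lifelike_freezing (triangular_nbhd n) k1 k2) x (i, j, d)"
proof (rule fires_eventually_iff_unstable[where \<kappa> = "\<lambda>(a, b, e). (a, b, of_bool e)"])
  show "triangular_nbhd n c \<subseteq> triangular_grid n" if "c \<in> triangular_grid n" for c
  proof -
    obtain a b e where "c = (a, b, e)" by (metis prod_cases3)
    then show ?thesis using that by (cases e) (auto simp: triangular_grid_def)
  qed
  show "set (nbr_ids True n a b e) =
      (\<lambda>d. case case d of (a, b, e) \<Rightarrow> (a, b, of_bool e) of (a, b, e) \<Rightarrow> cell_id True n a b e)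
        ` triangular_nbhd n c"
    if "c \<in> triangular_grid n" "(case c of (a, b, e) \<Rightarrow> (a, b, of_bool e)) = (a, b, e)" for c a b e
  proof -
    obtain a' b' e' where "c = (a', b', e')" by (metis prod_cases3)
    then show ?thesis using that by (cases e') (auto simp: nbr_ids_def Let_def)
  qed
  show "x c = r ! cell_id True n a b e"
    if "c \<in> triangular_grid n" "(case c of (a, b, e) \<Rightarrow> (a, b, of_bool e)) = (a, b, e)" for c a b e
  proof -
    obtain a' b' e' where "c = (a', b', e')" by (metis prod_cases3)
    then show ?thesis using that x by (auto simp: triangular_grid_def cell_id_def)
  qed
  show "cell_range True n a b e \<longleftrightarrow> (a, b, e) \<in> (\<lambda>(a, b, e). (a, b, of_bool e)) ` triangular_grid n" for a b e
  proof
    assume "cell_range True n a b e"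
    then have "(a, b, e = 1) \<in> triangular_grid n" "e = of_bool (e = 1)"
      by (auto simp: cell_range_def triangular_grid_def)
    then show "(a, b, e) \<in> (\<lambda>(a, b, e). (a, b, of_bool e)) ` triangular_grid n"
      by (intro image_eqI[of _ _ "(a, b, e = 1)"]) auto
  next
    assume "(a, b, e) \<in> (\<lambda>(a, b, e). (a, b, of_bool e)) ` triangular_grid n"
    then show "cell_range True n a b e" by (auto simp: cell_range_def triangular_grid_def)
  qed
qed (use k u in \<open>auto simp: triangular_grid_def inj_on_def\<close>)

text \<open>For the converse direction the configuration is read off from the remainder
  \<open>r\<close> of the word, and \<open>n \<ge> 1\<close> comes from
  \<open>i < n\<close>.\<close>

lemma AsyncUnstability_S_iff_accepts:
  assumes k: "k1 \<le> 1" "1 \<le> k2"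
  shows "w \<in> AsyncUnstability_S k1 k2 \<longleftrightarrow> accepts False k1 k2 w"
proof
  assume "w \<in> AsyncUnstability_S k1 k2"
  then obtain n x i j where w: "w = encode_square n x (i, j)" and u: "(i, j) \<in> square_grid n"
    and unst: "async_unstable (square_grid n) (lifelike_freezing (square_nbhd n) k1 k2) x (i, j)"
    by (auto simp: AsyncUnstability_S_def)
  define r where "r = concat (map (\<lambda>a. map (\<lambda>b. x (a, b)) [0..<n]) [0..<n])"
  have w': "w = unary n @ unary i @ unary j @ r" by (simp add: w r_def)
  have "length r = n * n" unfolding r_def by (rule length_concat_uniform) simp
  moreover have "x (a, b) = r ! (a * n + b)" if "a < n" "b < n" for a b
    unfolding r_def using nth_concat_uniform[of n "\<lambda>a. map (\<lambda>b. x (a, b)) [0..<n]" n a b] that by simp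
  ultimately show "accepts False k1 k2 w"
    using square_fires_iff_unstable[OF k u, of x r] unst u
    by (simp add: accepts_unary_iff[OF w'] square_grid_def)
next
  assume acc: "accepts False k1 k2 w"
  obtain n i j r where w: "w = unary n @ unary i @ unary j @ r"
    using accepts_imp_unary[OF acc] by blast
  have ij: "i < n" "j < n" and len: "length r = n * n"
    and fire: "fires_eventually False n k1 k2 r (cell_id False n i j (of_bool (r ! 0)))"
    using acc by (simp_all add: accepts_unary_iff[OF w])
  define x where "x = (\<lambda>(a, b). r ! (a * n + b))"
  have "w = encode_square n x (i, j)"
    using concat_chunks[OF len] by (simp add: w x_def)
  moreover have u: "(i, j) \<in> square_grid n" using ij by (simp add: square_grid_def)
  moreover have "async_unstable (square_grid n) (lifelike_freezing (square_nbhd n) k1 k2) x (i, j)"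
    using square_fires_iff_unstable[OF k u, of x r] fire by (simp add: x_def)
  ultimately show "w \<in> AsyncUnstability_S k1 k2"
    using ij unfolding AsyncUnstability_S_def by fastforce
qed

lemma concat_pairs_nth:
  fixes g :: "nat \<Rightarrow> nat \<Rightarrow> bool \<Rightarrow> 'b"
  assumes "a < n" and "b < n"
  shows "concat (map (\<lambda>a. concat (map (\<lambda>b. [g a b False, g a b True]) [0..<n])) [0..<n])
    ! (2 * (a * n + b) + of_bool e) = g a b e"
proof -
  let ?f = "\<lambda>a. concat (map (\<lambda>b. [g a b False, g a b True]) [0..<n])"
  have "b * 2 + of_bool e < Suc b * 2" by simp
  also have "\<dots> \<le> n * 2" using assms by (intro mult_right_mono) auto
  finally have "concat (map ?f [0..<n]) ! (a * (n * 2) + (b * 2 + of_bool e)) = ?f a ! (b * 2 + of_bool e)"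
    using assms by (intro nth_concat_uniform length_concat_uniform) auto
  also have "\<dots> = [g a b False, g a b True] ! of_bool e"
    using assms by (intro nth_concat_uniform) auto
  also have "\<dots> = g a b e" by (cases e) auto
  finally show ?thesis by (simp add: algebra_simps)
qed

lemma AsyncUnstability_T_iff_accepts:
  assumes k: "k1 \<le> 1" "1 \<le> k2"
  shows "w \<in> AsyncUnstability_T k1 k2 \<longleftrightarrow> accepts True k1 k2 w"
proof
  assume "w \<in> AsyncUnstability_T k1 k2"
  then obtain n x i j d where w: "w = encode_triangular n x (i, j, d)" and u: "(i, j, d) \<in> triangular_grid n"
    and unst: "async_unstable (triangular_grid n) (lifelike_freezing (triangular_nbhd n) k1 k2) x (i, j, d)"
    by (auto simp: AsyncUnstability_T_def)
  define r where
    "r = concat (map (\<lambda>a. concat (map (\<lambda>b. [x (a, b, False), x (a, b, True)]) [0..<n])) [0..<n])"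
  have w': "w = unary n @ unary i @ unary j @ (d # r)" by (simp add: w r_def)
  have "length r = n * (n * 2)"
    unfolding r_def by (intro length_concat_uniform) auto
  moreover have "x (a, b, e) = r ! (2 * (a * n + b) + of_bool e)" if "a < n" "b < n" for a b e
    unfolding r_def using concat_pairs_nth[OF that, of "\<lambda>a b e. x (a, b, e)" e] by simp
  ultimately show "accepts True k1 k2 w"
    using triangular_fires_iff_unstable[OF k u, of x r] unst u
    by (simp add: accepts_unary_iff[OF w'] triangular_grid_def)
next
  assume acc: "accepts True k1 k2 w"
  obtain n i j s where w: "w = unary n @ unary i @ unary j @ s"
    using accepts_imp_unary[OF acc] by blast
  have ij: "i < n" "j < n" and len: "length s = 1 + 2 * (n * n)"
    and fire: "fires_eventually True n k1 k2 (drop 1 s) (cell_id True n i j (of_bool (s ! 0)))"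
    using acc by (simp_all add: accepts_unary_iff[OF w])
  obtain d r where s: "s = d # r" using len by (cases s) auto
  define x where "x = (\<lambda>(a, b, e). r ! (2 * (a * n + b) + of_bool e))"
  have "concat (map (\<lambda>a. concat (map (\<lambda>b. [x (a, b, False), x (a, b, True)]) [0..<n])) [0..<n]) = r"
    (is "concat (map ?f _) = _")
  proof (rule nth_equalityI)
    have "length (concat (map ?f [0..<n])) = n * (n * 2)"
      by (intro length_concat_uniform) auto
    then show len': "length (concat (map ?f [0..<n])) = length r" using len s by simp
    fix t assume "t < length (concat (map ?f [0..<n]))"
    then have t: "t div 2 < n * n" using len len' s by simp
    then have n: "0 < n" by (cases n) auto
    let ?a = "t div 2 div n" and ?b = "t div 2 mod n"
    have ab: "?a < n" "?b < n" using t n by (simp_all add: less_mult_imp_div_less)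
    \<comment> \<open>The position \<open>t\<close> is decomposed as in the triangular code: its
      parity is the orientation and \<open>t div 2\<close> numbers the rhombus.\<close>
    have eq: "2 * (?a * n + ?b) + of_bool (odd t) = t"
      by (simp add: mod_2_eq_odd[symmetric])
    have "x (?a, ?b, odd t) = r ! t" by (simp only: x_def prod.case eq)
    then show "concat (map ?f [0..<n]) ! t = r ! t"
      using concat_pairs_nth[OF ab, of "\<lambda>a b e. x (a, b, e)" "odd t"] unfolding eq by (rule trans[rotated])
  qed
  then have "w = encode_triangular n x (i, j, d)"
    by (simp add: w s)
  moreover have u: "(i, j, d) \<in> triangular_grid n" using ij by (simp add: triangular_grid_def)
  moreover have "async_unstable (triangular_grid n) (lifelike_freezing (triangular_nbhd n) k1 k2) x (i, j, d)"
    using triangular_fires_iff_unstable[OF k u, of x r] fire by (simp add: x_def s)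
  ultimately show "w \<in> AsyncUnstability_T k1 k2"
    using ij unfolding AsyncUnstability_T_def by fastforce
qed

theorem theorem2:
  shows "{AsyncUnstability_T 0 1, AsyncUnstability_T 0 2,
          AsyncUnstability_T 1 1, AsyncUnstability_T 1 2,
          AsyncUnstability_S 0 1, AsyncUnstability_S 0 2, AsyncUnstability_S 0 3,
          AsyncUnstability_S 1 1, AsyncUnstability_S 1 2, AsyncUnstability_S 1 3} \<subseteq> NC"
  \<comment> \<open>All ten rules satisfy \<open>k1 \<le> 1\<close> and \<open>1 \<le> k2\<close>,
    so the criterion applies to each.\<close>
  using accepts_in_NC[OF AsyncUnstability_T_iff_accepts]
    accepts_in_NC[OF AsyncUnstability_S_iff_accepts]
  by simp

end
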